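(* Let $\Phi_1$ and $\Phi_2$ be two $\mathcal{C}^1$ convex growth functions with $\Phi_2\in\mathscr{U}$. Assume that $\Phi_1$ satisfies the $\nabla_2$-condition and that $\frac{\Phi_2}{\Phi_1}$ is nondecreasing. Let $\mu$ be a positive Borel measure on $\mathbb{C}_+$ and let $\alpha>-1$. Then the following assertions are equivalent. (a) There exists a constant $C_1>0$ such that for any interval $I\subset \mathbb{R}$, $$\mu(Q_I)\le \frac{C_1}{\Phi_2\circ\Phi_1^{-1}\left(\frac{1}{|I|^{2+\alpha}}\right)}.$$ (b) There exists a constant $C_2>0$ such that $$\sup_{z=x+iy\in \mathbb{C}_+}\int_{\mathbb{C}_+}\Phi_2\left(\Phi_1^{-1}\left(\frac{1}{y^{2+\alpha}}\right)\frac{y^{4+2\alpha}}{|z-\bar{w}|^{4+2\alpha}}\right)d\mu(w)\le C_2<\infty.$$ (c) There exists a constant $C_3>0$ such that for any $f\in A_\alpha^{\Phi_1}(\mathbb{C}_+)$, $f\neq 0$, $$\int_{\mathbb{C}_+}\Phi_2\left(\frac{|f(z)|}{C_3\|f\|_{A_\alpha^{\Phi_1}}^{lux}}\right)d\mu(z)<\infty.$$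
   Context: $\mathbb{C}_+=\{x+iy: y>0\}$. A growth function is a continuous nondecreasing function $\Phi$ from $[0,\infty)$ onto $[0,\infty)$; $\Phi^{-1}$ is its inverse. $\Phi$ is of upper type $q$ if $\Phi(st)\le Ct^q\Phi(s)$ for $s>0$, $t\ge1$; $\mathscr{U}^q$ is the set of growth functions of upper type $q\ge1$ with $t\mapsto\Phi(t)/t$ nondecreasing, $\mathscr{U}=\bigcup_{q\ge1}\mathscr{U}^q$. $\Delta_2$-condition: $\Phi(2t)\le K\Phi(t)$ for some $K>1$, all $t\ge0$; a convex $\Phi$ satisfies the $\nabla_2$-condition if $\Phi$ and its complementary function $\Psi(s)=\sup_{t\ge0}\{ts-\Phi(t)\}$ both satisfy $\Delta_2$. For an interval $I$, $Q_I=\{x+iy:x\in I,0<y<|I|\}$. For $\alpha>-1$, $dV_\alpha(x+iy)=y^\alpha dx\,dy$; the Bergman–Orlicz space $A^\Phi_\alpha(\mathbb{C}_+)$ is the space of holomorphic $f$ on $\mathbb{C}_+$ with $\int_{\mathbb{C}_+}\Phi(|f|)dV_\alpha<\infty$, with Luxemburg quasi-norm $\|f\|_{A^\Phi_\alpha}^{lux}=\inf\{\lambda>0:\int_{\mathbb{C}_+}\Phi(|f(z)|/\lambda)dV_\alpha(z)\le1\}$. *)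

theory Defs
  imports "HOL-Analysis.Analysis"
begin

definition growth_fun :: "(real \<Rightarrow> real) \<Rightarrow> bool" where
  "growth_fun \<Phi> \<longleftrightarrow> continuous_on {0..} \<Phi> \<and> mono_on {0..} \<Phi> \<and> \<Phi> ` {0..} = {0..}"

text \<open>Inverse of a growth function (unique for positive arguments when the function is convex).\<close>
definition growth_inv :: "(real \<Rightarrow> real) \<Rightarrow> real \<Rightarrow> real" where
  "growth_inv \<Phi> s = Inf {t. 0 \<le> t \<and> \<Phi> t = s}"

definition C1_on_nonneg :: "(real \<Rightarrow> real) \<Rightarrow> bool" where
  "C1_on_nonneg \<Phi> \<longleftrightarrow> (\<exists>\<Phi>'. continuous_on {0..} \<Phi>' \<and>
      (\<forall>t\<ge>0. (\<Phi> has_real_derivative \<Phi>' t) (at t within {0..})))"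

definition upper_type :: "(real \<Rightarrow> real) \<Rightarrow> real \<Rightarrow> bool" where
  "upper_type \<Phi> q \<longleftrightarrow> (\<exists>C. \<forall>s>0. \<forall>t\<ge>1. \<Phi> (s * t) \<le> C * t powr q * \<Phi> s)"

definition class_U_q :: "real \<Rightarrow> (real \<Rightarrow> real) set" where
  "class_U_q q = {\<Phi>. growth_fun \<Phi> \<and> upper_type \<Phi> q \<and> mono_on {0<..} (\<lambda>t. \<Phi> t / t)}"

definition class_U :: "(real \<Rightarrow> real) set" where
  "class_U = (\<Union>q\<in>{1..}. class_U_q q)"

definition Delta2 :: "(real \<Rightarrow> real) \<Rightarrow> bool" where
  "Delta2 \<Phi> \<longleftrightarrow> (\<exists>K>1. \<forall>t\<ge>0. \<Phi> (2 * t) \<le> K * \<Phi> t)"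

text \<open>Complementary function, extended-real valued (it may be infinite).\<close>
definition compl_fun :: "(real \<Rightarrow> real) \<Rightarrow> real \<Rightarrow> ereal" where
  "compl_fun \<Phi> s = (SUP t\<in>{0..}. ereal (t * s - \<Phi> t))"

definition Delta2_ereal :: "(real \<Rightarrow> ereal) \<Rightarrow> bool" where
  "Delta2_ereal \<Psi> \<longleftrightarrow> (\<exists>K>1. \<forall>t\<ge>0. \<Psi> (2 * t) \<le> ereal K * \<Psi> t)"

definition Nabla2 :: "(real \<Rightarrow> real) \<Rightarrow> bool" where
  "Nabla2 \<Phi> \<longleftrightarrow> convex_on {0..} \<Phi> \<and> Delta2 \<Phi> \<and> Delta2_ereal (compl_fun \<Phi>)"

definition upper_half_plane :: "complex set" where
  "upper_half_plane = {z. 0 < Im z}"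

text \<open>Carleson box Q_I for an interval I of length l = |I|.\<close>
definition carleson_box :: "real set \<Rightarrow> real \<Rightarrow> complex set" where
  "carleson_box I l = {z. Re z \<in> I \<and> 0 < Im z \<and> Im z < l}"

definition orlicz_modular :: "(real \<Rightarrow> real) \<Rightarrow> real \<Rightarrow> (complex \<Rightarrow> complex) \<Rightarrow> ennreal" where
  "orlicz_modular \<Phi> \<alpha> f =
     (\<integral>\<^sup>+ z\<in>upper_half_plane. ennreal (\<Phi> (cmod (f z)) * Im z powr \<alpha>) \<partial>lborel)"

definition bergman_orlicz :: "(real \<Rightarrow> real) \<Rightarrow> real \<Rightarrow> (complex \<Rightarrow> complex) set" where
  "bergman_orlicz \<Phi> \<alpha> = {f. f holomorphic_on upper_half_plane \<and> orlicz_modular \<Phi> \<alpha> f < \<infinity>}"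

definition lux_norm :: "(real \<Rightarrow> real) \<Rightarrow> real \<Rightarrow> (complex \<Rightarrow> complex) \<Rightarrow> real" where
  "lux_norm \<Phi> \<alpha> f = Inf {r. 0 < r \<and> orlicz_modular \<Phi> \<alpha> (\<lambda>z. f z / of_real r) \<le> 1}"

end

theory Submission
  imports Defs "HOL-Complex_Analysis.Complex_Analysis"
begin

text \<open>
  Write $G(v) = \Phi_2(\Phi_1^{-1}(v^{-2-\alpha}))$. Averaging Cauchy's formula over concentric squares
  and applying Jensen's inequality gives, for a function $f$ of modular at most 1, the local estimate
  $\Phi_1(c|f(w)|) \le m(w) v^{-2-\alpha}$ with $v = {\rm Im}\, w$, where $m(w) \le 1$ is the modular of $f$
  over a square around $w$ of size comparable to $v$. As $\Phi_2/\Phi_1$ is nondecreasing, this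
  improves to $\Phi_2(c|f(w)|) \le m(w) G(v)$. Integrating against $\mu$ and exchanging the integrals, (a) bounds
  $\int \Phi_2(c|f|)\, d\mu$ uniformly; no maximal function is needed. This yields (c), and also (b), because the
  integrand in (b) is $\Phi_2$ of the modulus of a holomorphic function whose modular is bounded uniformly in $z$.

  Conversely, that function is comparable to its maximum on a Carleson box, so (b) implies (a). Assertion
  (c) provides only finiteness, with no uniform bound. The uniform bound is recovered from the Baire
  category theorem, applied to the coefficient sequences $t$ of the series $\sum_n t_n 2^{-n-1} f_n$, where the
  $f_n$ are test functions attached to boxes that violate (a) more and more badly.
\<close>

section \<open>Convex growth functions\<close>

text \<open>Constants pass through a growth function in one direction by convexity
  (\<open>scale_le\<close>). The other direction is \<open>dilation\<close>, the common form in
  which the Delta2 condition of \<open>\<Phi>1\<close> and the upper type of \<open>\<Phi>2\<close>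
  are used. Two obstacles shape the exchange of integrals. No sigma-finiteness of
  \<open>\<mu>\<close> is given; the Carleson condition itself supplies it on the half-plane. And
  the weight \<open>G (Im w)\<close> has to become a function of z before w is integrated out, which
  the comparable heights in a square allow. For (c), Baire is applied to bounded sequences instead
  of the function space: their completeness is elementary, and the weights 2^(-n-1), having sum 1,
  make every bounded sequence an admissible coefficient sequence. The price is that the n-th test
  function is bounded only after scaling by a multiple of 2^(-n). This loss is harmless, because the
  lower estimate on a box holds for scaled test functions too, with a constant that may depend on n,
  and if (a) fails it fails for every constant.\<close>

locale young =
  fixes \<Phi> :: "real \<Rightarrow> real"
  assumes growth: "growth_fun \<Phi>"
    and convex: "convex_on {0..} \<Phi>"
    and pos: "\<And>t. 0 < t \<Longrightarrow> 0 < \<Phi> t"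
    and dilation: "\<And>c. 1 \<le> c \<Longrightarrow> \<exists>D>0. \<forall>t\<ge>0. \<Phi> (c * t) \<le> D * \<Phi> t"
begin

lemma mono: "0 \<le> s \<Longrightarrow> s \<le> t \<Longrightarrow> \<Phi> s \<le> \<Phi> t"
  using growth by (auto simp: growth_fun_def mono_on_def)

lemma image_nonneg: "\<Phi> ` {0..} = {0..}"
  using growth by (auto simp: growth_fun_def)

lemma nonneg: "0 \<le> t \<Longrightarrow> 0 \<le> \<Phi> t"
  using image_nonneg by auto

lemma zero: "\<Phi> 0 = 0"
proof -
  obtain t where "t \<ge> 0" "\<Phi> t = 0" using image_nonneg by (metis atLeast_iff imageE order_refl)
  then show ?thesis using mono[of 0 t] nonneg[of 0] by auto
qed

lemma cont: "continuous_on {0..} \<Phi>"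
  using growth by (auto simp: growth_fun_def)

lemma scale_le: "0 \<le> c \<Longrightarrow> c \<le> 1 \<Longrightarrow> 0 \<le> t \<Longrightarrow> \<Phi> (c * t) \<le> c * \<Phi> t"
  using convex_onD[OF convex, of c 0 t] zero by simp

lemma scale_ge: "1 \<le> c \<Longrightarrow> 0 \<le> t \<Longrightarrow> c * \<Phi> t \<le> \<Phi> (c * t)"
  using scale_le[of "1 / c" "c * t"] by (simp add: field_simps)

text \<open>Convexity and \<open>zero\<close> give \<Phi>(s) \<le> (s/t) \<Phi>(t), and positivity
  of \<Phi>(t) makes this smaller than \<Phi>(t). Strictness turns \<open>growth_inv\<close> into a
  genuine inverse.\<close>

lemma strict:
  assumes "0 \<le> s" "s < t"
  shows "\<Phi> s < \<Phi> t"
proof -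
  have t: "t > 0" using assms by simp
  have "\<Phi> (s / t * t) \<le> s / t * \<Phi> t" using assms by (intro scale_le) auto
  also have "\<dots> < 1 * \<Phi> t" using assms t pos[OF t] by (intro mult_strict_right_mono) auto
  finally show ?thesis using t by simp
qed

lemma le_iff: "0 \<le> s \<Longrightarrow> 0 \<le> t \<Longrightarrow> \<Phi> s \<le> \<Phi> t \<longleftrightarrow> s \<le> t"
  using strict[of t s] mono[of s t] by (cases "s \<le> t") auto

lemma inv_unique:
  assumes "0 \<le> t" shows "growth_inv \<Phi> (\<Phi> t) = t"
proof -
  have "u = t" if "0 \<le> u" "\<Phi> u = \<Phi> t" for u
    using strict[of u t] strict[of t u] that assms by (cases u t rule: linorder_cases) auto
  then have "{u. 0 \<le> u \<and> \<Phi> u = \<Phi> t} = {t}"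
    using assms by auto
  then show ?thesis by (simp add: growth_inv_def)
qed

lemma
  assumes "0 \<le> s"
  shows inv_nonneg: "0 \<le> growth_inv \<Phi> s" and inv_eq: "\<Phi> (growth_inv \<Phi> s) = s"
proof -
  obtain t where "0 \<le> t" "\<Phi> t = s" using image_nonneg assms by (metis atLeast_iff imageE)
  then show "0 \<le> growth_inv \<Phi> s" "\<Phi> (growth_inv \<Phi> s) = s" using inv_unique by auto
qed

lemma inv_mono: "0 \<le> s \<Longrightarrow> s \<le> t \<Longrightarrow> growth_inv \<Phi> s \<le> growth_inv \<Phi> t"
  using le_iff[of "growth_inv \<Phi> s" "growth_inv \<Phi> t"] by (simp add: inv_nonneg inv_eq)

lemma inv_pos: "0 < s \<Longrightarrow> 0 < growth_inv \<Phi> s"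
  using inv_nonneg[of s] inv_eq[of s] zero by (cases "growth_inv \<Phi> s = 0") auto

lemma inv_scale:
  assumes "1 \<le> c" "0 \<le> s"
  shows "growth_inv \<Phi> (c * s) \<le> c * growth_inv \<Phi> s"
proof -
  have "\<Phi> (growth_inv \<Phi> (c * s)) \<le> \<Phi> (c * growth_inv \<Phi> s)"
    using scale_ge[of c "growth_inv \<Phi> s"] assms by (simp add: inv_nonneg inv_eq)
  then show ?thesis using assms by (subst (asm) le_iff) (auto simp: inv_nonneg)
qed

lemma support_line:
  assumes "0 \<le> a"
  obtains m where "\<And>t. 0 \<le> t \<Longrightarrow> \<Phi> a + m * (t - a) \<le> \<Phi> t"
proof (cases "a = 0")
  \<comment> \<open>The endpoint 0 is not interior, so the subdifferential result does not apply;
    slope 0 supports there because \<Phi> is nonnegative and vanishes at 0.\<close>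
  case True
  then show ?thesis using nonneg zero that[of 0] by auto
next
  case False
  then have "a \<in> interior {0..}" using assms by simp
  then show ?thesis using convex_le_Inf_differential[OF convex] that by (metis atLeast_iff)
qed

lemma borel_measurable_comp [measurable]:
  assumes [measurable]: "g \<in> borel_measurable M" and g: "\<And>x. 0 \<le> g x"
  shows "(\<lambda>x. \<Phi> (g x)) \<in> borel_measurable M"
proof -
  \<comment> \<open>Continuity is known only on the nonnegative axis; \<open>max 0\<close> extends
    the function continuously to the whole line without changing it at the values of
    \<open>g\<close>.\<close>
  have "continuous_on UNIV (\<lambda>t. \<Phi> (max 0 t))"
    by (intro continuous_on_compose2[OF cont] continuous_intros) auto
  then have [measurable]: "(\<lambda>t. \<Phi> (max 0 t)) \<in> borel_measurable borel"
    by (rule borel_measurable_continuous_onI)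
  have "(\<lambda>x. \<Phi> (max 0 (g x))) \<in> borel_measurable M" by measurable
  then show ?thesis using g by (simp add: max_absorb2)
qed

text \<open>Jensen's inequality for an increasing convex function, where the mean of
  \<open>g\<close> is known only to be at least \<open>b\<close>. Unnormalised and in extended
  reals, so that no integrability of \<open>g\<close> has to be checked.\<close>

lemma jensen_nn_integral:
  assumes [measurable]: "g \<in> borel_measurable M" and g: "\<And>x. 0 \<le> g x"
    and A [measurable]: "A \<in> sets M" and mA: "emeasure M A = ennreal V" and V: "V > 0"
    and b: "0 \<le> b" "ennreal (V * b) \<le> (\<integral>\<^sup>+x\<in>A. ennreal (g x) \<partial>M)"
  shows "ennreal (V * \<Phi> b) \<le> (\<integral>\<^sup>+x\<in>A. ennreal (\<Phi> (g x)) \<partial>M)"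
proof -
  obtain m where m: "\<And>t. 0 \<le> t \<Longrightarrow> \<Phi> b + m * (t - b) \<le> \<Phi> t" using support_line[OF b(1)] by blast
  \<comment> \<open>A negative slope would reverse the lower bound on the mean. Clipping it at 0 is
    allowed: for t \<ge> b monotonicity suffices, for t < b the original line does.\<close>
  define m' where "m' = max m 0"
  \<comment> \<open>This arrangement has no subtraction, so it can be integrated in the extended
    nonnegative reals; the finite term \<open>V * (m' * b)\<close> is cancelled at the end.\<close>
  have m': "\<Phi> b + m' * t \<le> m' * b + \<Phi> t" if "0 \<le> t" for t
  proof (cases "m \<ge> 0")
    case True then show ?thesis using m[OF that] by (simp add: m'_def algebra_simps max_def)
  next
    case False
    have "\<Phi> b \<le> \<Phi> t"
    proof (cases "t \<ge> b")
      case True then show ?thesis using mono b by auto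
    next
      case f: False
      then have "m * (t - b) \<ge> 0" using False by (intro mult_nonpos_nonpos) auto
      then show ?thesis using m[OF that] by simp
    qed
    then show ?thesis using False by (simp add: m'_def)
  qed
  have m'0: "m' \<ge> 0" by (simp add: m'_def)
  have lin: "(\<integral>\<^sup>+x\<in>A. ennreal (c + d * h x) \<partial>M) = ennreal (V * c) + ennreal d * (\<integral>\<^sup>+x\<in>A. ennreal (h x) \<partial>M)"
    if [measurable]: "h \<in> borel_measurable M" and h: "\<And>x. 0 \<le> h x" and "c \<ge> 0" "d \<ge> 0" for c d h
  proof -
    have "(\<integral>\<^sup>+x\<in>A. ennreal (c + d * h x) \<partial>M)
        = (\<integral>\<^sup>+x. ennreal c * indicator A x + ennreal d * (ennreal (h x) * indicator A x) \<partial>M)"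
      using that by (intro nn_integral_cong) (simp add: ennreal_plus ennreal_mult distrib_right mult.assoc)
    also have "\<dots> = ennreal c * emeasure M A + ennreal d * (\<integral>\<^sup>+x\<in>A. ennreal (h x) \<partial>M)"
      by (simp add: nn_integral_add nn_integral_cmult nn_integral_cmult_indicator)
    finally show ?thesis using that V by (simp add: mA ennreal_mult mult.commute)
  qed
  have "ennreal (V * \<Phi> b) + ennreal (V * (m' * b)) = ennreal (V * \<Phi> b) + ennreal m' * ennreal (V * b)"
    using V b m'0 by (simp add: ennreal_mult[symmetric] mult.left_commute)
  also have "\<dots> \<le> ennreal (V * \<Phi> b) + ennreal m' * (\<integral>\<^sup>+x\<in>A. ennreal (g x) \<partial>M)"
    by (intro add_left_mono mult_left_mono b) auto
  also have "\<dots> = (\<integral>\<^sup>+x\<in>A. ennreal (\<Phi> b + m' * g x) \<partial>M)"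
    using m'0 g nonneg b by (subst lin) auto
  also have "\<dots> \<le> (\<integral>\<^sup>+x\<in>A. ennreal (m' * b + 1 * \<Phi> (g x)) \<partial>M)"
    using m' g by (intro nn_integral_mono mult_right_mono ennreal_leI) auto
  also have "\<dots> = ennreal (V * (m' * b)) + (\<integral>\<^sup>+x\<in>A. ennreal (\<Phi> (g x)) \<partial>M)"
    using m'0 g nonneg b by (subst lin) auto
  finally show ?thesis by (simp add: ennreal_add_left_cancel_le add.commute)
qed

end

section \<open>A mean value inequality on squares\<close>

lemma measurable_Complex [measurable]: "case_prod Complex \<in> borel \<Otimes>\<^sub>M borel \<rightarrow>\<^sub>M borel"
proof -
  have "case_prod Complex = (\<lambda>p. of_real (fst p) + \<i> * of_real (snd p))"
    by (auto simp: fun_eq_iff complex_eq_iff)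
  then show ?thesis by simp
qed

lemma lborel_complex: "(lborel :: complex measure) = distr (lborel \<Otimes>\<^sub>M lborel) borel (case_prod Complex)"
proof (rule lborel_eqI)
  fix l u :: complex
  assume le: "\<And>b. b \<in> Basis \<Longrightarrow> l \<bullet> b \<le> u \<bullet> b"
  then have le': "Re l \<le> Re u" "Im l \<le> Im u"
    using le[of 1] le[of \<i>] by (auto simp: Basis_complex_def)
  have [measurable]: "box l u \<in> sets borel" by simp
  have "case_prod Complex -` box l u = {Re l<..<Re u} \<times> {Im l<..<Im u}"
    by (auto simp: in_box_complex_iff)
  then have "emeasure (distr (lborel \<Otimes>\<^sub>M lborel) borel (case_prod Complex)) (box l u)
      = emeasure (lborel \<Otimes>\<^sub>M lborel) ({Re l<..<Re u} \<times> {Im l<..<Im u})"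
    by (subst emeasure_distr) (auto simp: space_pair_measure)
  also have "\<dots> = ennreal (\<Prod>b\<in>Basis. (u - l) \<bullet> b)"
    using le' by (subst lborel.emeasure_pair_measure_Times)
      (auto simp: Basis_complex_def ennreal_mult)
  finally show "emeasure (distr (lborel \<Otimes>\<^sub>M lborel) borel (case_prod Complex)) (box l u)
      = ennreal (\<Prod>b\<in>Basis. (u - l) \<bullet> b)" .
qed auto

lemma nn_integral_complex_iterated:
  assumes [measurable]: "f \<in> borel_measurable borel"
  shows "(\<integral>\<^sup>+z. f z \<partial>lborel) = (\<integral>\<^sup>+x. \<integral>\<^sup>+y. f (Complex x y) \<partial>lborel \<partial>lborel)"
proof -
  have "(\<integral>\<^sup>+z. f z \<partial>lborel) = (\<integral>\<^sup>+p. f (case_prod Complex p) \<partial>(lborel \<Otimes>\<^sub>M lborel))"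
    by (subst lborel_complex) (simp add: nn_integral_distr)
  also have "\<dots> = (\<integral>\<^sup>+x. \<integral>\<^sup>+y. f (Complex x y) \<partial>lborel \<partial>lborel)"
    by (subst lborel.nn_integral_fst[symmetric]) auto
  finally show ?thesis .
qed

lemma nn_integral_complex_iterated':
  assumes [measurable]: "f \<in> borel_measurable borel"
  shows "(\<integral>\<^sup>+z. f z \<partial>lborel) = (\<integral>\<^sup>+y. \<integral>\<^sup>+x. f (Complex x y) \<partial>lborel \<partial>lborel)"
  using lborel_pair.Fubini'[of "\<lambda>x y. f (Complex x y)"] by (simp add: nn_integral_complex_iterated)

lemma i_complex: "\<i> * Complex x y = Complex (- y) x"
  by (simp add: complex_eq_iff)

text \<open>The map sends (x, y) to (-y, x): a swap of coordinates, absorbed by exchanging the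
  iterated integrals, followed by a reflection of one real variable.\<close>

lemma nn_integral_complex_mult_i:
  assumes [measurable]: "f \<in> borel_measurable borel"
  shows "(\<integral>\<^sup>+z. f (\<i> * z) \<partial>lborel) = (\<integral>\<^sup>+z. f z \<partial>lborel)"
proof -
  have "(\<integral>\<^sup>+z. f (\<i> * z) \<partial>lborel) = (\<integral>\<^sup>+y. \<integral>\<^sup>+x. f (\<i> * Complex x y) \<partial>lborel \<partial>lborel)"
    by (rule nn_integral_complex_iterated') measurable
  also have "\<dots> = (\<integral>\<^sup>+y. \<integral>\<^sup>+x. f (Complex (- y) x) \<partial>lborel \<partial>lborel)"
    by (simp only: i_complex)
  also have "\<dots> = (\<integral>\<^sup>+y. \<integral>\<^sup>+x. f (Complex y x) \<partial>lborel \<partial>lborel)"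
    using nn_integral_real_affine[of "\<lambda>y. \<integral>\<^sup>+x. f (Complex y x) \<partial>lborel" "-1" 0] by simp
  also have "\<dots> = (\<integral>\<^sup>+z. f z \<partial>lborel)" by (simp add: nn_integral_complex_iterated)
  finally show ?thesis .
qed

text \<open>Makes the four sides of a square copies of a single one. The factors -1 and -i are
  obtained by repeating the turn by i.\<close>

lemma nn_integral_complex_rotate:
  assumes [measurable]: "f \<in> borel_measurable borel" and u: "u \<in> {1, \<i>, -1, -\<i>}"
  shows "(\<integral>\<^sup>+z. f (w + u * z) \<partial>lborel) = (\<integral>\<^sup>+z. f z \<partial>(lborel :: complex measure))"
proof -
  have *: "(\<integral>\<^sup>+z. g (w + z) \<partial>lborel) = (\<integral>\<^sup>+z. g z \<partial>(lborel :: complex measure))"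
    if [measurable]: "g \<in> borel_measurable borel" for g :: "complex \<Rightarrow> ennreal"
    by (subst (2) lborel_distr_plus[symmetric, of w]) (simp add: nn_integral_distr)
  have i: "(\<integral>\<^sup>+z. g (w + \<i> * z) \<partial>lborel) = (\<integral>\<^sup>+z. g (w + z) \<partial>lborel)"
    if [measurable]: "g \<in> borel_measurable borel" for g
    by (rule nn_integral_complex_mult_i) measurable
  have m: "(\<integral>\<^sup>+z. g (w + - z) \<partial>lborel) = (\<integral>\<^sup>+z. g (w + z) \<partial>lborel)"
    if [measurable]: "g \<in> borel_measurable borel" for g :: "complex \<Rightarrow> ennreal"
    using nn_integral_complex_mult_i[of "\<lambda>z. g (w + \<i> * z)"] i[of g] by simp
  have "(\<integral>\<^sup>+z. g (w + -(\<i> * z)) \<partial>lborel) = (\<integral>\<^sup>+z. g (w + z) \<partial>lborel)"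
    if [measurable]: "g \<in> borel_measurable borel" for g :: "complex \<Rightarrow> ennreal"
    using nn_integral_complex_mult_i[of "\<lambda>z. g (w + - z)"] m[of g] by simp
  then show ?thesis using u * i m by auto
qed

lemma borel_measurable_ennreal_indicator:
  fixes g :: "'a::topological_space \<Rightarrow> real"
  assumes "continuous_on A g" "A \<in> sets borel"
  shows "(\<lambda>x. ennreal (g x) * indicator A x) \<in> borel_measurable borel"
proof -
  have "(\<lambda>x. ennreal (g x) * indicator A x) = (\<lambda>x. ennreal (indicator A x *\<^sub>R g x))"
    by (auto simp: indicator_def)
  then show ?thesis using borel_measurable_continuous_on_indicator[OF assms(2,1)] by simp
qed

text \<open>One side of a square centred at w, the unit u selecting the side.\<close>

lemma norm_contour_integral_square_side:
  fixes f :: "complex \<Rightarrow> complex"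
  assumes s: "0 < s" and u: "cmod u = 1"
    and f: "continuous_on (closed_segment (w + u * Complex s (-s)) (w + u * Complex s s)) f"
  shows "ennreal (norm (contour_integral (linepath (w + u * Complex s (-s)) (w + u * Complex s s)) (\<lambda>z. f z / (z - w))))
    \<le> ennreal (1 / s) * (\<integral>\<^sup>+t. ennreal (norm (f (w + u * Complex s t))) * indicator {-s..s} t \<partial>lborel)"
proof -
  define A B where "A = w + u * Complex s (-s)" and "B = w + u * Complex s s"
  have lp: "linepath A B x = w + u * Complex s (s * (2 * x - 1))" for x
    by (simp add: linepath_def A_def B_def scaleR_conv_of_real algebra_simps complex_eq_iff)
  have BA: "cmod (B - A) = 2 * s"
  proof -
    have "B - A = u * (\<i> * of_real (2 * s))" by (simp add: A_def B_def complex_eq_iff algebra_simps)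
    then show ?thesis using s u by (simp add: norm_mult)
  qed
  \<comment> \<open>Before the rotation by \<open>u\<close> the side has real part \<open>s\<close>,
    and \<open>u\<close> preserves moduli, so the Cauchy kernel is at most 1/s along the
    side.\<close>
  have dist: "s \<le> cmod (linepath A B x - w)" for x
    using s complex_Re_le_cmod[of "Complex s (s * (2 * x - 1))"] by (simp add: lp norm_mult u)
  have cf: "continuous_on {0..1} (\<lambda>x. f (linepath A B x))"
    using f unfolding A_def[symmetric] B_def[symmetric]
    by (intro continuous_on_compose2[OF f[unfolded A_def[symmetric] B_def[symmetric]]])
       (auto simp: linepath_in_path intro!: continuous_intros)
  have seg: "s \<le> cmod (z - w)" if "z \<in> closed_segment A B" for z
    using that dist by (metis linepath_image_01 imageE)
  have "continuous_on (closed_segment A B) (\<lambda>z. f z / (z - w))"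
    using f seg s by (intro continuous_intros) (force simp: A_def B_def)+
  then have "((\<lambda>z. f z / (z - w)) has_contour_integral contour_integral (linepath A B) (\<lambda>z. f z / (z - w))) (linepath A B)"
    by (intro has_contour_integral_integral contour_integrable_continuous_linepath)
  then have hi: "((\<lambda>x. f (linepath A B x) / (linepath A B x - w) * (B - A)) has_integral
       contour_integral (linepath A B) (\<lambda>z. f z / (z - w))) {0..1}"
    by (simp add: has_contour_integral_linepath)
  have hn: "((\<lambda>x. 2 * norm (f (linepath A B x))) has_integral integral {0..1} (\<lambda>x. 2 * norm (f (linepath A B x)))) {0..1}"
    by (intro integrable_integral integrable_continuous_real continuous_intros cf)
  have "norm (contour_integral (linepath A B) (\<lambda>z. f z / (z - w))) \<le> integral {0..1} (\<lambda>x. 2 * norm (f (linepath A B x)))"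
  proof -
    \<comment> \<open>The factor 2 is the length 2s of the side times the kernel bound 1/s.\<close>
    have "norm (f (linepath A B x) / (linepath A B x - w) * (B - A)) \<le> 2 * norm (f (linepath A B x))" for x
    proof -
      have "norm (f (linepath A B x)) * s \<le> norm (f (linepath A B x)) * cmod (linepath A B x - w)"
        by (intro mult_left_mono dist) auto
      moreover have "cmod (linepath A B x - w) > 0" using dist[of x] s by linarith
      ultimately show ?thesis
        by (simp add: norm_mult norm_divide BA divide_simps mult.commute)
    qed
    then have "norm (integral {0..1} (\<lambda>x. f (linepath A B x) / (linepath A B x - w) * (B - A))) \<le> integral {0..1} (\<lambda>x. 2 * norm (f (linepath A B x)))"
      using hi hn by (intro integral_norm_bound_integral) (auto simp: has_integral_iff)
    then show ?thesis using integral_unique[OF hi] by simp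
  qed
  then have "ennreal (norm (contour_integral (linepath A B) (\<lambda>z. f z / (z - w)))) \<le> ennreal (integral {0..1} (\<lambda>x. 2 * norm (f (linepath A B x))))"
    by (rule ennreal_leI)
  also have "\<dots> = (\<integral>\<^sup>+x. ennreal (2 * norm (f (linepath A B x)) * indicator {0..1} x) \<partial>lborel)"
  proof -
    have "((\<lambda>x. 2 * norm (f (linepath A B x)) * indicator {0..1} x) has_integral integral {0..1} (\<lambda>x. 2 * norm (f (linepath A B x)))) UNIV"
    proof -
      have "(\<lambda>x. 2 * norm (f (linepath A B x)) * indicator {0..1} x) = (\<lambda>x. if x \<in> {0..1} then 2 * norm (f (linepath A B x)) else 0)"
        by (auto simp: fun_eq_iff)
      then show ?thesis using hn by (simp only: has_integral_restrict_UNIV)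
    qed
    moreover have "(\<lambda>x. indicator {0..1} x *\<^sub>R (2 * norm (f (linepath A B x)))) \<in> borel_measurable borel"
      by (intro borel_measurable_continuous_on_indicator continuous_intros cf) auto
    ultimately show ?thesis
      by (subst nn_integral_has_integral_lborel) (auto simp: mult.commute)
  qed
  also have "\<dots> = ennreal (1 / s) * (\<integral>\<^sup>+t. ennreal (norm (f (w + u * Complex s t))) * indicator {-s..s} t \<partial>lborel)"
  proof -
    have [measurable]: "(\<lambda>t. ennreal (norm (f (w + u * Complex s t))) * indicator {-s..s} t) \<in> borel_measurable borel"
    proof (intro borel_measurable_ennreal_indicator continuous_intros continuous_on_compose2[OF f])
      show "(\<lambda>x. w + u * Complex s x) ` {- s..s} \<subseteq> closed_segment (w + u * Complex s (- s)) (w + u * Complex s s)"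
      proof safe
        fix t assume "t \<in> {-s..s}"
        then have "w + u * Complex s t = linepath A B ((t + s) / (2 * s))" "(t + s) / (2 * s) \<in> {0..1}"
          using s by (auto simp: lp field_simps)
        then show "w + u * Complex s t \<in> closed_segment (w + u * Complex s (- s)) (w + u * Complex s s)"
          unfolding A_def[symmetric] B_def[symmetric] by (metis linepath_in_path)
      qed
    qed (auto simp: Complex_eq intro!: continuous_intros)
    \<comment> \<open>The substitution t = -s + 2sx passes from the parameter interval [0,1] to the
      actual side; its Jacobian 2s turns the factor 2 into 1/s.\<close>
    have "(\<integral>\<^sup>+t. ennreal (norm (f (w + u * Complex s t))) * indicator {-s..s} t \<partial>lborel)
       = ennreal (2 * s) * (\<integral>\<^sup>+x. ennreal (norm (f (linepath A B x))) * indicator {0..1} x \<partial>lborel)"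
    proof -
      have "-s + 2 * s * x = s * (2 * x - 1)" for x by (simp add: algebra_simps)
      moreover have "indicator {-s..s} (s * (2 * x - 1)) = (indicator {0..1} x :: ennreal)" for x
      proof -
        have "-s \<le> s * (2 * x - 1) \<longleftrightarrow> s * 0 \<le> s * x" "s * (2 * x - 1) \<le> s \<longleftrightarrow> s * x \<le> s * 1"
          by (auto simp: algebra_simps)
        then show ?thesis using s by (simp add: indicator_def zero_le_mult_iff)
      qed
      ultimately show ?thesis
        using s by (subst nn_integral_real_affine[where c="2 * s" and t="-s"]) (auto simp: lp)
    qed
    also have "ennreal (1/s) * \<dots> = ennreal 2 * (\<integral>\<^sup>+x. ennreal (norm (f (linepath A B x))) * indicator {0..1} x \<partial>lborel)"
      using s by (simp add: mult.assoc[symmetric] ennreal_mult[symmetric])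
    also have "\<dots> = (\<integral>\<^sup>+x. ennreal (2 * norm (f (linepath A B x)) * indicator {0..1} x) \<partial>lborel)"
    proof -
      have [measurable]: "(\<lambda>x. ennreal (norm (f (linepath A B x))) * indicator {0..1} x) \<in> borel_measurable borel"
        by (intro borel_measurable_ennreal_indicator continuous_intros cf) auto
      show ?thesis
        by (subst nn_integral_cmult[symmetric]) (auto simp: ennreal_mult intro!: nn_integral_cong split: split_indicator)
    qed
    finally show ?thesis by simp
  qed
  finally show ?thesis by (simp add: A_def B_def)
qed

section \<open>The mean value inequality on squares\<close>

definition square :: "complex \<Rightarrow> real \<Rightarrow> complex set" where
  "square w R = cbox (w - Complex R R) (w + Complex R R)"

lemma mem_square: "z \<in> square w R \<longleftrightarrow> \<bar>Re z - Re w\<bar> \<le> R \<and> \<bar>Im z - Im w\<bar> \<le> R"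
  by (auto simp: square_def in_cbox_complex_iff)

lemma square_sets [measurable]: "square w R \<in> sets borel"
  by (simp add: square_def)

lemma convex_square: "convex (square w R)"
  by (simp add: square_def)

lemma emeasure_square: "0 \<le> R \<Longrightarrow> emeasure lborel (square w R) = ennreal (4 * R\<^sup>2)"
  unfolding square_def by (subst emeasure_lborel_cbox) (auto simp: Basis_complex_def power2_eq_square)

text \<open>Cauchy's formula at the centre, over the boundary of the concentric square of half-side
  \<open>s\<close>. Writing every side as a rotation of the right-hand one makes a single estimate
  serve for all four.\<close>

lemma norm_center_le_square_sides:
  fixes f :: "complex \<Rightarrow> complex"
  assumes f: "f holomorphic_on square w R" and s: "0 < s" "s \<le> R"
  defines "U \<equiv> {1, \<i>, -1, -\<i>} :: complex set"
  shows "ennreal (2 * pi * norm (f w)) \<le>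
    (\<Sum>u\<in>U. ennreal (1 / s) * (\<integral>\<^sup>+t. ennreal (norm (f (w + u * Complex s t))) * indicator {-s..s} t \<partial>lborel))"
proof -
  define I where "I u = contour_integral (linepath (w + u * Complex s (-s)) (w + u * Complex s s)) (\<lambda>z. f z / (z - w))" for u
  let ?p = "rectpath (w - Complex s s) (w + Complex s s)"
  have sub: "cbox (w - Complex s s) (w + Complex s s) \<subseteq> square w R"
    using s by (auto simp: square_def in_cbox_complex_iff)
  have wb: "w \<in> box (w - Complex s s) (w + Complex s s)"
    using s by (auto simp: in_box_complex_iff)
  have "path_image ?p = cbox (w - Complex s s) (w + Complex s s) - box (w - Complex s s) (w + Complex s s)"
    using s by (intro path_image_rectpath_cbox_minus_box) auto
  then have pim: "path_image ?p \<subseteq> square w R - {w}" using sub wb by auto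
  have "w \<in> box (w - Complex R R) (w + Complex R R)"
    using s by (auto simp: in_box_complex_iff)
  then have "((\<lambda>z. f z / (z - w)) has_contour_integral 2 * pi * \<i> * winding_number ?p w * f w) ?p"
    using pim f by (intro Cauchy_integral_formula_convex_simple[where S = "square w R"])
      (auto simp: square_def interior_cbox)
  then have int: "((\<lambda>z. f z / (z - w)) has_contour_integral 2 * pi * \<i> * f w) ?p"
    using wb by (simp add: winding_number_rectpath)
  \<comment> \<open>The units -i, 1, i, -1 give the bottom, right, top and left side, in the order
    and orientation in which \<open>rectpath\<close> runs through them.\<close>
  have eqs: "w + - \<i> * Complex s (-s) = w - Complex s s" "w + - \<i> * Complex s s = Complex (Re (w + Complex s s)) (Im (w - Complex s s))"
     "w + 1 * Complex s (-s) = Complex (Re (w + Complex s s)) (Im (w - Complex s s))" "w + 1 * Complex s s = w + Complex s s"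
     "w + \<i> * Complex s (-s) = w + Complex s s" "w + \<i> * Complex s s = Complex (Re (w - Complex s s)) (Im (w + Complex s s))"
     "w + -1 * Complex s (-s) = Complex (Re (w - Complex s s)) (Im (w + Complex s s))" "w + -1 * Complex s s = w - Complex s s"
     by (simp_all add: complex_eq_iff)
  have rect: "?p = linepath (w + - \<i> * Complex s (-s)) (w + - \<i> * Complex s s) +++ linepath (w + 1 * Complex s (-s)) (w + 1 * Complex s s)
      +++ linepath (w + \<i> * Complex s (-s)) (w + \<i> * Complex s s) +++ linepath (w + -1 * Complex s (-s)) (w + -1 * Complex s s)"
    unfolding eqs rectpath_def Let_def ..
  have "2 * pi * \<i> * f w = I (-\<i>) + (I 1 + (I \<i> + I (-1)))"
  proof -
    have "2 * pi * \<i> * f w = contour_integral ?p (\<lambda>z. f z / (z - w))"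
      using contour_integral_unique[OF int] by simp
    moreover have "(\<lambda>z. f z / (z - w)) contour_integrable_on ?p"
      using int by (auto simp: contour_integrable_on_def)
    ultimately show ?thesis unfolding rect I_def eqs by simp
  qed
  then have "norm (2 * pi * \<i> * f w) \<le> norm (I (-\<i>)) + (norm (I 1) + (norm (I \<i>) + norm (I (-1))))"
    by (metis (no_types, opaque_lifting) add_left_mono norm_triangle_ineq order_trans)
  then have "2 * pi * norm (f w) \<le> (\<Sum>u\<in>U. norm (I u))"
    by (simp add: U_def norm_mult complex_eq_iff)
  then have "ennreal (2 * pi * norm (f w)) \<le> (\<Sum>u\<in>U. ennreal (norm (I u)))"
    by (subst sum_ennreal) (auto intro: ennreal_leI)
  also have "\<dots> \<le> (\<Sum>u\<in>U. ennreal (1 / s) * (\<integral>\<^sup>+t. ennreal (norm (f (w + u * Complex s t))) * indicator {-s..s} t \<partial>lborel))"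
    unfolding I_def
  proof (intro sum_mono norm_contour_integral_square_side s)
    fix u assume u: "u \<in> U"
    then show "cmod u = 1" by (auto simp: U_def)
    have "closed_segment (w + u * Complex s (-s)) (w + u * Complex s s) \<subseteq> square w R"
      using u s by (intro closed_segment_subset) (auto simp: U_def mem_square convex_square)
    then show "continuous_on (closed_segment (w + u * Complex s (-s)) (w + u * Complex s s)) f"
      using f holomorphic_on_imp_continuous_on continuous_on_subset by blast
  qed
  finally show ?thesis .
qed

text \<open>Integrate the preceding bound over half-sides between R/2 and R; squares make this an iterated
  integral, so polar coordinates are avoided.\<close>

lemma norm_center_le_square_integral:
  fixes f :: "complex \<Rightarrow> complex"
  assumes f: "f holomorphic_on square w R" and R: "0 < R"
  shows "ennreal (R\<^sup>2 / 4 * norm (f w)) \<le> (\<integral>\<^sup>+z\<in>square w R. ennreal (norm (f z)) \<partial>lborel)"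
proof -
  define U :: "complex set" where "U = {1, \<i>, -1, -\<i>}"
  define G where "G z = ennreal (norm (f z)) * indicator (square w R) z" for z
  have [measurable]: "G \<in> borel_measurable borel"
    unfolding G_def using f
    by (intro borel_measurable_ennreal_indicator continuous_intros holomorphic_on_imp_continuous_on) auto
  have K [measurable]: "(\<lambda>s. \<integral>\<^sup>+t. G (w + u * Complex s t) \<partial>lborel) \<in> borel_measurable borel" for u
    by measurable
  \<comment> \<open>Staying away from the centre keeps the factor 1/s below 2/R.\<close>
  have *: "ennreal (2 * pi * norm (f w)) \<le> (\<Sum>u\<in>U. ennreal (2 / R) * (\<integral>\<^sup>+t. G (w + u * Complex s t) \<partial>lborel))"
    if s: "R / 2 \<le> s" "s \<le> R" for s
  proof -
    have "ennreal (2 * pi * norm (f w)) \<le>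
      (\<Sum>u\<in>U. ennreal (1 / s) * (\<integral>\<^sup>+t. ennreal (norm (f (w + u * Complex s t))) * indicator {-s..s} t \<partial>lborel))"
      unfolding U_def using f s R by (intro norm_center_le_square_sides) auto
    also have "\<dots> \<le> (\<Sum>u\<in>U. ennreal (2 / R) * (\<integral>\<^sup>+t. G (w + u * Complex s t) \<partial>lborel))"
    proof (intro sum_mono mult_mono nn_integral_mono ennreal_leI)
      show "1 / s \<le> 2 / R" using s R by (simp add: field_simps)
      fix u t assume "u \<in> U"
      then show "ennreal (norm (f (w + u * Complex s t))) * indicator {-s..s} t \<le> G (w + u * Complex s t)"
        using s by (auto simp: G_def U_def mem_square indicator_def)
    qed auto
    finally show ?thesis .
  qed
  have "ennreal (2 * pi * norm (f w)) * ennreal (R / 2) = (\<integral>\<^sup>+s\<in>{R/2..R}. ennreal (2 * pi * norm (f w)) \<partial>lborel)"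
    using R by (simp add: nn_integral_cmult_indicator)
  also have "\<dots> \<le> (\<integral>\<^sup>+s\<in>{R/2..R}. (\<Sum>u\<in>U. ennreal (2 / R) * (\<integral>\<^sup>+t. G (w + u * Complex s t) \<partial>lborel)) \<partial>lborel)"
    using * by (intro nn_integral_mono) (auto simp: indicator_def)
  \<comment> \<open>Once s is unrestricted, each of the four terms becomes the integral of
    \<open>G\<close> over the whole plane. Every point is then counted four times, which only costs
    a constant.\<close>
  also have "\<dots> \<le> (\<integral>\<^sup>+s. (\<Sum>u\<in>U. ennreal (2 / R) * (\<integral>\<^sup>+t. G (w + u * Complex s t) \<partial>lborel)) \<partial>lborel)"
    by (intro nn_integral_mono) (auto simp: indicator_def)
  also have "\<dots> = (\<Sum>u\<in>U. ennreal (2 / R) * (\<integral>\<^sup>+s. \<integral>\<^sup>+t. G (w + u * Complex s t) \<partial>lborel \<partial>lborel))"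
    by (simp add: nn_integral_sum nn_integral_cmult)
  also have "\<dots> = (\<Sum>u\<in>U. ennreal (2 / R) * (\<integral>\<^sup>+z. G z \<partial>lborel))"
  proof (intro sum.cong refl arg_cong2[where f="(*)"])
    fix u assume "u \<in> U"
    then show "(\<integral>\<^sup>+s. \<integral>\<^sup>+t. G (w + u * Complex s t) \<partial>lborel \<partial>lborel) = (\<integral>\<^sup>+z. G z \<partial>lborel)"
      using nn_integral_complex_iterated[of "\<lambda>z. G (w + u * z)"] nn_integral_complex_rotate[of G u w]
      by (simp add: U_def)
  qed
  also have "\<dots> = 4 * (ennreal (2 / R) * (\<integral>\<^sup>+z. G z \<partial>lborel))"
    by (simp add: U_def complex_eq_iff)
  \<comment> \<open>The factor R/8 is the inverse of 4 * (2/R). On the left it leaves pi R^2 / 8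
    times the value at the centre, and pi \<ge> 2 reduces this to R^2 / 4.\<close>
  finally have "ennreal (R / 8) * (ennreal (2 * pi * norm (f w)) * ennreal (R / 2))
      \<le> ennreal (R / 8) * (4 * (ennreal (2 / R) * (\<integral>\<^sup>+z. G z \<partial>lborel)))"
    by (rule mult_left_mono) auto
  also have "\<dots> = (ennreal (R / 8) * (ennreal 4 * ennreal (2 / R))) * (\<integral>\<^sup>+z. G z \<partial>lborel)"
    by (simp add: mult.assoc)
  also have "ennreal (R / 8) * (ennreal 4 * ennreal (2 / R)) = ennreal (R / 8 * (4 * (2 / R)))"
    using R by (subst ennreal_mult, simp, simp, subst ennreal_mult) auto
  also have "\<dots> = 1" using R by simp
  also have "1 * (\<integral>\<^sup>+z. G z \<partial>lborel) = (\<integral>\<^sup>+z. G z \<partial>lborel)" by simp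
  also have "ennreal (R / 8) * (ennreal (2 * pi * norm (f w)) * ennreal (R / 2)) = ennreal (R\<^sup>2 * pi / 8 * norm (f w))"
    using R by (simp add: ennreal_mult[symmetric] power2_eq_square mult_ac)
  finally have "ennreal (R\<^sup>2 * pi / 8 * norm (f w)) \<le> (\<integral>\<^sup>+z. G z \<partial>lborel)" .
  moreover have "R\<^sup>2 / 4 * norm (f w) \<le> R\<^sup>2 * pi / 8 * norm (f w)"
    using mult_left_mono[OF pi_ge_two, of "R\<^sup>2"] by (intro mult_right_mono) auto
  ultimately show ?thesis unfolding G_def by (meson ennreal_leI order_trans)
qed

section \<open>Bergman--Orlicz spaces\<close>

abbreviation (input) "\<H> \<equiv> upper_half_plane"

lemma open_upper_half_plane: "open \<H>"
  unfolding upper_half_plane_def by (rule open_halfspace_Im_gt)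

lemma upper_half_plane_sets [measurable]: "\<H> \<in> sets borel"
  using open_upper_half_plane by auto

lemma square_subset_upper_half_plane: "w \<in> \<H> \<Longrightarrow> square w (Im w / 2) \<subseteq> \<H>"
  by (auto simp: upper_half_plane_def mem_square abs_if split: if_splits)

lemma borel_measurable_holomorphic_indicator:
  assumes "f holomorphic_on \<H>"
  shows "(\<lambda>z. norm (f z) * indicator \<H> z) \<in> borel_measurable borel"
  using borel_measurable_continuous_on_indicator[OF upper_half_plane_sets, of "\<lambda>z. norm (f z)"] assms
  by (simp add: continuous_on_norm holomorphic_on_imp_continuous_on mult.commute)

context young
begin

text \<open>Off the half-plane \<open>f\<close> is arbitrary and possibly not measurable, so it is
  truncated before \<Phi> is applied.\<close>

lemma borel_measurable_modular_integrand:
  assumes "f holomorphic_on \<H>"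
  shows "(\<lambda>z. ennreal (\<Phi> (norm (f z)) * Im z powr \<alpha>) * indicator \<H> z) \<in> borel_measurable borel"
proof -
  note [measurable] = borel_measurable_holomorphic_indicator[OF assms]
  have "(\<lambda>z. ennreal (\<Phi> (norm (f z) * indicator \<H> z) * Im z powr \<alpha>) * indicator \<H> z) \<in> borel_measurable borel"
    by measurable
  then show ?thesis
    by (rule measurable_cong[THEN iffD1, rotated]) (auto simp: indicator_def)
qed

lemma modular_square_le:
  assumes "w \<in> \<H>"
  shows "(\<integral>\<^sup>+z\<in>square w (Im w / 2). ennreal (\<Phi> (norm (f z)) * Im z powr \<alpha>) \<partial>lborel) \<le> orlicz_modular \<Phi> \<alpha> f"
  unfolding orlicz_modular_def using square_subset_upper_half_plane[OF assms]
  by (intro nn_integral_mono) (auto simp: indicator_def)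

text \<open>Jensen over the square of side Im w around w, combined with the mean value inequality.
  Heights in that square lie between 1/2 and 3/2 of Im w, so the weight is comparable to its value
  at the centre. The constant sits inside \<Phi>, where convexity lets it absorb all
  factors.\<close>

lemma modular_local_estimate:
  obtains c where "0 < c"
    "\<And>f w. f holomorphic_on \<H> \<Longrightarrow> w \<in> \<H> \<Longrightarrow> ennreal (\<Phi> (c * norm (f w))) \<le>
      ennreal (1 / Im w powr (2 + \<alpha>)) * (\<integral>\<^sup>+z\<in>square w (Im w / 2). ennreal (\<Phi> (norm (f z)) * Im z powr \<alpha>) \<partial>lborel)"
proof -
  \<comment> \<open>The minimum of t^\<alpha> for t in [1/2, 3/2]; the sign of \<alpha> decides
    which endpoint attains it.\<close>
  define k where "k = min ((1 / 2) powr \<alpha>) ((3 / 2) powr \<alpha>)"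
  have k: "k > 0" by (simp add: k_def)
  \<comment> \<open>The 16 comes from the mean value inequality with half-side v/2, where (v/2)^2 /
    4 = v^2 / 16, against the area v^2. The minimum with 1 is there because \<open>scale_le\<close>
    moves only factors at most 1 out of \<Phi>.\<close>
  define c where "c = min 1 k / 16"
  have "c > 0" using k by (simp add: c_def)
  moreover have "ennreal (\<Phi> (c * norm (f w))) \<le>
      ennreal (1 / Im w powr (2 + \<alpha>)) * (\<integral>\<^sup>+z\<in>square w (Im w / 2). ennreal (\<Phi> (norm (f z)) * Im z powr \<alpha>) \<partial>lborel)"
    if f: "f holomorphic_on \<H>" and w: "w \<in> \<H>" for f w
  proof -
    define v where "v = Im w"
    have v: "v > 0" using w by (simp add: v_def upper_half_plane_def)
    define b where "b = norm (f w) / 16"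
    define g where "g z = norm (f z) * indicator \<H> z" for z
    have g_eq: "g z = norm (f z)" if "z \<in> square w (v / 2)" for z
      using that square_subset_upper_half_plane[OF w] by (auto simp: g_def v_def)
    have g_meas [measurable]: "g \<in> borel_measurable lborel"
      using borel_measurable_holomorphic_indicator[OF f] by (simp add: g_def[abs_def])
    have g0: "0 \<le> g z" for z by (simp add: g_def)
    have "ennreal (v\<^sup>2 * \<Phi> b) \<le> (\<integral>\<^sup>+z\<in>square w (v / 2). ennreal (\<Phi> (g z)) \<partial>lborel)"
    proof (rule jensen_nn_integral[OF g_meas g0])
      show "emeasure lborel (square w (v / 2)) = ennreal (v\<^sup>2)"
        using emeasure_square[of "v/2" w] v by (simp add: power2_eq_square)
      have "ennreal ((v/2)\<^sup>2 / 4 * norm (f w)) \<le> (\<integral>\<^sup>+z\<in>square w (v/2). ennreal (norm (f z)) \<partial>lborel)"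
        using f w v square_subset_upper_half_plane[OF w]
        by (intro norm_center_le_square_integral) (auto simp: v_def holomorphic_on_subset)
      also have "\<dots> = (\<integral>\<^sup>+z\<in>square w (v/2). ennreal (g z) \<partial>lborel)"
        by (intro nn_integral_cong) (auto simp: g_eq indicator_def)
      finally show "ennreal (v\<^sup>2 * b) \<le> (\<integral>\<^sup>+z\<in>square w (v/2). ennreal (g z) \<partial>lborel)"
        by (simp add: b_def power2_eq_square)
    qed (use v in \<open>auto simp: b_def\<close>)
    then have "ennreal (k * v powr \<alpha>) * ennreal (v\<^sup>2 * \<Phi> b)
        \<le> ennreal (k * v powr \<alpha>) * (\<integral>\<^sup>+z\<in>square w (v / 2). ennreal (\<Phi> (g z)) \<partial>lborel)"
      by (rule mult_left_mono) auto
    also have "\<dots> = (\<integral>\<^sup>+z. ennreal (k * v powr \<alpha>) * (ennreal (\<Phi> (g z)) * indicator (square w (v / 2)) z) \<partial>lborel)"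
      using borel_measurable_comp[OF g_meas g0] by (subst nn_integral_cmult) auto
    also have "\<dots> \<le> (\<integral>\<^sup>+z\<in>square w (v / 2). ennreal (\<Phi> (norm (f z)) * Im z powr \<alpha>) \<partial>lborel)"
    proof (intro nn_integral_mono)
      fix z
      have kz: "k * v powr \<alpha> \<le> Im z powr \<alpha>" if z: "z \<in> square w (v / 2)"
      proof (cases "\<alpha> \<ge> 0")
        case True
        have "k * v powr \<alpha> \<le> (1 / 2) powr \<alpha> * v powr \<alpha>" by (intro mult_right_mono) (auto simp: k_def)
        also have "\<dots> = (v / 2) powr \<alpha>" using v by (simp add: powr_mult[symmetric])
        also have "\<dots> \<le> Im z powr \<alpha>"
          using z v True unfolding mem_square abs_le_iff v_def by (intro powr_mono2) auto
        finally show ?thesis .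
      next
        case False
        have "k * v powr \<alpha> \<le> (3 / 2) powr \<alpha> * v powr \<alpha>" by (intro mult_right_mono) (auto simp: k_def)
        also have "\<dots> = (3 / 2 * v) powr \<alpha>" using v by (simp add: powr_mult[symmetric])
        also have "\<dots> \<le> Im z powr \<alpha>"
          using z v False unfolding mem_square abs_le_iff v_def by (intro powr_mono2') auto
        finally show ?thesis .
      qed
      show "ennreal (k * v powr \<alpha>) * (ennreal (\<Phi> (g z)) * indicator (square w (v / 2)) z)
          \<le> ennreal (\<Phi> (norm (f z)) * Im z powr \<alpha>) * indicator (square w (v / 2)) z"
      proof (cases "z \<in> square w (v / 2)")
        case True
        have "k * v powr \<alpha> * \<Phi> (norm (f z)) \<le> Im z powr \<alpha> * \<Phi> (norm (f z))"
          using kz[OF True] nonneg by (intro mult_right_mono) auto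
        then have "ennreal (k * v powr \<alpha>) * ennreal (\<Phi> (norm (f z))) \<le> ennreal (\<Phi> (norm (f z)) * Im z powr \<alpha>)"
          using k by (subst ennreal_mult'[symmetric]) (auto intro: ennreal_leI simp: mult.commute)
        then show ?thesis using True g_eq[OF True] by simp
      qed simp
    qed
    finally have *: "ennreal (k * v powr \<alpha>) * ennreal (v\<^sup>2 * \<Phi> b)
        \<le> (\<integral>\<^sup>+z\<in>square w (v / 2). ennreal (\<Phi> (norm (f z)) * Im z powr \<alpha>) \<partial>lborel)" .
    have b: "0 \<le> b" by (simp add: b_def)
    have "\<Phi> (c * norm (f w)) = \<Phi> (min 1 k * b)" by (simp add: c_def b_def)
    also have "\<dots> \<le> min 1 k * \<Phi> b" using k b by (intro scale_le) auto
    also have "\<dots> \<le> k * \<Phi> b" using nonneg[OF b] by (intro mult_right_mono) auto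
    also have "\<dots> = 1 / v powr (2 + \<alpha>) * (k * v powr \<alpha> * (v\<^sup>2 * \<Phi> b))"
      using v by (simp add: powr_add powr_numeral)
    finally have "ennreal (\<Phi> (c * norm (f w))) \<le> ennreal (1 / v powr (2 + \<alpha>)) * (ennreal (k * v powr \<alpha>) * ennreal (v\<^sup>2 * \<Phi> b))"
      using k nonneg[OF b] by (simp add: ennreal_mult[symmetric] ennreal_leI)
    also have "\<dots> \<le> ennreal (1 / v powr (2 + \<alpha>)) * (\<integral>\<^sup>+z\<in>square w (v / 2). ennreal (\<Phi> (norm (f z)) * Im z powr \<alpha>) \<partial>lborel)"
      by (intro mult_left_mono *) auto
    finally show ?thesis by (simp add: v_def)
  qed
  ultimately show ?thesis by (rule that)
qed

text \<open>The local estimate with the local modular replaced by 1. This continuity of point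
  evaluations makes series converge locally uniformly and the Luxemburg norm definite.\<close>

lemma modular_pointwise_bound:
  obtains c where "0 < c"
    "\<And>f w. f holomorphic_on \<H> \<Longrightarrow> orlicz_modular \<Phi> \<alpha> f \<le> 1 \<Longrightarrow> w \<in> \<H> \<Longrightarrow>
      norm (f w) \<le> c * growth_inv \<Phi> (1 / Im w powr (2 + \<alpha>))"
proof -
  obtain c where c: "0 < c"
    and *: "\<And>f w. f holomorphic_on \<H> \<Longrightarrow> w \<in> \<H> \<Longrightarrow> ennreal (\<Phi> (c * norm (f w))) \<le>
      ennreal (1 / Im w powr (2 + \<alpha>)) * (\<integral>\<^sup>+z\<in>square w (Im w / 2). ennreal (\<Phi> (norm (f z)) * Im z powr \<alpha>) \<partial>lborel)"
    using modular_local_estimate by blast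
  show ?thesis
  proof
    show "0 < 1 / c" using c by simp
    fix f w assume f: "f holomorphic_on \<H>" "orlicz_modular \<Phi> \<alpha> f \<le> 1" and w: "w \<in> \<H>"
    have "ennreal (\<Phi> (c * norm (f w))) \<le> ennreal (1 / Im w powr (2 + \<alpha>)) * 1"
      using modular_square_le[OF w, of f \<alpha>] f(2)
      by (intro order_trans[OF *[OF f(1) w]] mult_left_mono) auto
    then have "\<Phi> (c * norm (f w)) \<le> \<Phi> (growth_inv \<Phi> (1 / Im w powr (2 + \<alpha>)))"
      by (simp add: inv_eq)
    then have "c * norm (f w) \<le> growth_inv \<Phi> (1 / Im w powr (2 + \<alpha>))"
      using c by (subst (asm) le_iff) (auto simp: inv_nonneg)
    then show "norm (f w) \<le> 1 / c * growth_inv \<Phi> (1 / Im w powr (2 + \<alpha>))"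
      using c by (simp add: field_simps)
  qed
qed

end

section \<open>The embedding under the Carleson condition\<close>

locale carleson_setting = P1: young \<Phi>1 + P2: young \<Phi>2 for \<Phi>1 \<Phi>2 :: "real \<Rightarrow> real" +
  fixes \<alpha> :: real and \<mu> :: "complex measure"
  assumes ratio: "mono_on {0<..} (\<lambda>t. \<Phi>2 t / \<Phi>1 t)"
    and alpha: "-1 < \<alpha>"
    and sets_mu [measurable_cong, simp]: "sets \<mu> = sets borel"
begin

section \<open>The weight G and its scaling\<close>

definition G :: "real \<Rightarrow> real" where
  "G v = \<Phi>2 (growth_inv \<Phi>1 (1 / v powr (2 + \<alpha>)))"

lemma G_pos: "0 < v \<Longrightarrow> 0 < G v"
  by (simp add: G_def P2.pos P1.inv_pos)

lemma G_antimono: "0 < v \<Longrightarrow> v \<le> v' \<Longrightarrow> G v' \<le> G v"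
  unfolding G_def using alpha
  by (intro P2.mono P1.inv_mono P1.inv_nonneg divide_left_mono powr_mono2) auto

text \<open>The factor 6 is 4 * (3/2): if z lies in the square around w, then Im z \<le> (3/2) Im w,
  and the Carleson box used for z has size 4 Im z.\<close>

lemma G_dilation:
  obtains D where "0 < D" "\<And>v. 0 < v \<Longrightarrow> G v \<le> D * G (6 * v)"
proof -
  define c where "c = 6 powr (2 + \<alpha>)"
  have c: "1 \<le> c" using alpha unfolding c_def by (intro ge_one_powr_ge_zero) auto
  obtain D where D: "0 < D" "\<And>t. 0 \<le> t \<Longrightarrow> \<Phi>2 (c * t) \<le> D * \<Phi>2 t"
    using P2.dilation[OF c] by blast
  have "G v \<le> D * G (6 * v)" if "0 < v" for v
  proof -
    have "G v = \<Phi>2 (growth_inv \<Phi>1 (c * (1 / (6 * v) powr (2 + \<alpha>))))"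
      using that by (simp add: G_def c_def powr_mult)
    also have "\<dots> \<le> \<Phi>2 (c * growth_inv \<Phi>1 (1 / (6 * v) powr (2 + \<alpha>)))"
      using c by (intro P2.mono P1.inv_scale P1.inv_nonneg) auto
    also have "\<dots> \<le> D * G (6 * v)"
      unfolding G_def by (intro D P1.inv_nonneg) auto
    finally show ?thesis .
  qed
  with D(1) show ?thesis by (rule that)
qed

text \<open>Monotone functions are Borel, and -G is monotone on the positive axis. The indicator
  cuts off the remaining arguments.\<close>

lemma borel_measurable_G [measurable]: "(\<lambda>v. indicator {0<..} v *\<^sub>R G v) \<in> borel_measurable borel"
proof -
  have "(\<lambda>v. - G v) \<in> borel_measurable (restrict_space borel {0<..})"
    by (intro borel_measurable_mono_on_fnc) (auto simp: mono_on_def intro: G_antimono)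
  then have "(\<lambda>v. - (- G v)) \<in> borel_measurable (restrict_space borel {0<..})"
    by (rule borel_measurable_uminus)
  then show ?thesis by (subst (asm) borel_measurable_restrict_space_iff) auto
qed

text \<open>Put u = \<Phi>1^(-1)(s). Since m \<le> 1, the hypothesis forces h \<le> u, so the
  quotient \<Phi>2/\<Phi>1 at h is at most its value at u, and \<Phi>2(h) \<le> \<Phi>1(h)
  \<Phi>2(u)/s. This keeps the whole factor m, which is what gets integrated later; a bound by
  \<Phi>2(u) alone would lose it.\<close>

lemma superlinear:
  assumes h: "0 \<le> h" and m: "0 \<le> m" "m \<le> 1" and s: "0 < s" and le: "\<Phi>1 h \<le> m * s"
  shows "\<Phi>2 h \<le> m * \<Phi>2 (growth_inv \<Phi>1 s)"
proof (cases "h = 0")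
  case True
  then show ?thesis using m P2.zero P2.nonneg P1.inv_nonneg s by simp
next
  case False
  define u where "u = growth_inv \<Phi>1 s"
  have u: "u > 0" "\<Phi>1 u = s" using s by (auto simp: u_def P1.inv_pos P1.inv_eq)
  have "\<Phi>1 h \<le> 1 * s" using le m s by (meson mult_right_mono order_trans less_imp_le)
  then have "h \<le> u" using u h P1.le_iff[of h u] by simp
  then have "\<Phi>2 h / \<Phi>1 h \<le> \<Phi>2 u / \<Phi>1 u"
    using ratio False h u by (auto simp: mono_on_def)
  then have "\<Phi>2 h \<le> \<Phi>1 h * (\<Phi>2 u / s)"
    using P1.pos[of h] False h u by (simp add: field_simps)
  also have "\<dots> \<le> m * s * (\<Phi>2 u / s)"
    using le P2.nonneg[of u] u s by (intro mult_right_mono) auto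
  finally show ?thesis using s by (simp add: u_def)
qed

text \<open>Closed intervals suffice as the internal form of (a): the box over any other interval
  with the same endpoints is contained in the closed one.\<close>

definition carleson :: "real \<Rightarrow> bool" where
  "carleson C \<longleftrightarrow> (\<forall>a b. a < b \<longrightarrow> emeasure \<mu> (carleson_box {a..b} (b - a)) \<le> ennreal C / ennreal (G (b - a)))"

lemma carleson_box_sets [measurable]: "carleson_box {a..b} l \<in> sets borel"
  unfolding carleson_box_def by measurable

text \<open>\<open>\<mu>\<close> lives on the whole plane and may be arbitrarily large off the
  half-plane. Discarding that part by a density keeps the Borel sets of the plane and makes
  sigma-finiteness attainable.\<close>

definition M :: "complex measure" where
  "M = density \<mu> (indicator \<H>)"

lemma sets_M [measurable_cong, simp]: "sets M = sets borel"
  by (simp add: M_def)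

lemma nn_integral_M:
  assumes "f \<in> borel_measurable borel"
  shows "(\<integral>\<^sup>+z. f z \<partial>M) = (\<integral>\<^sup>+z\<in>\<H>. f z \<partial>\<mu>)"
  unfolding M_def using assms by (subst nn_integral_density) (auto simp: mult.commute)

lemma emeasure_M: "A \<in> sets borel \<Longrightarrow> emeasure M A = emeasure \<mu> (\<H> \<inter> A)"
  unfolding M_def by (subst emeasure_density) (auto simp: indicator_inter_arith[symmetric])

text \<open>Needed for Tonelli. Each Carleson box has finite measure because \<open>G\<close> is
  positive, growing boxes exhaust the half-plane, and its complement is
  \<open>M\<close>-null.\<close>

lemma sigma_finite_M:
  assumes "carleson C" and C: "0 \<le> C" shows "sigma_finite_measure M"
proof
  \<comment> \<open>\<open>Suc n\<close> keeps the base interval nondegenerate, as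
    \<open>carleson\<close> requires.\<close>
  define B where "B n = carleson_box {- real (Suc n)..real (Suc n)} (2 * real (Suc n))" for n
  have fin: "emeasure M (B n) < \<infinity>" for n
  proof -
    have "emeasure M (B n) \<le> emeasure \<mu> (B n)"
      by (subst emeasure_M) (auto simp: B_def intro!: emeasure_mono)
    also have "\<dots> \<le> ennreal C / ennreal (G (2 * real (Suc n)))"
      using assms(1)[unfolded carleson_def, rule_format, of "- real (Suc n)" "real (Suc n)"] by (simp add: B_def)
    also have "\<dots> = ennreal (C / G (2 * real (Suc n)))"
      by (intro divide_ennreal G_pos C) simp
    also have "\<dots> < \<infinity>" by simp
    finally show ?thesis .
  qed
  have cover: "\<H> \<subseteq> (\<Union>n. B n)"
  proof
    fix z assume z: "z \<in> \<H>"
    obtain n where "max \<bar>Re z\<bar> (Im z) < real n" using reals_Archimedean2 by blast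
    then have "z \<in> B n" using z by (auto simp: B_def carleson_box_def upper_half_plane_def)
    then show "z \<in> (\<Union>n. B n)" by blast
  qed
  show "\<exists>A. countable A \<and> A \<subseteq> sets M \<and> \<Union>A = space M \<and> (\<forall>a\<in>A. emeasure M a \<noteq> \<infinity>)"
  proof (intro exI conjI ballI)
    let ?A = "insert (- \<H>) (range B)"
    show "countable ?A" by simp
    show "?A \<subseteq> sets M" by (auto simp: B_def)
    have "space M = UNIV" using sets_eq_imp_space_eq[OF sets_M] by simp
    then show "\<Union>?A = space M" using cover by auto
    fix a assume "a \<in> ?A"
    then show "emeasure M a \<noteq> \<infinity>"
    proof
      assume "a = - \<H>" then show ?thesis by (simp add: emeasure_M)
    qed (use fin in \<open>auto simp: less_top[symmetric]\<close>)
  qed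
qed

text \<open>A point z enters the local modular of w only if w lies in a box of size comparable to Im
  z. The measure of that box is at most C/G, which cancels the weight G gained from
  \<open>superlinear\<close>; what remains is the modular of f.\<close>

lemma embedding:
  assumes C: "carleson C" "C > 0"
  obtains c C' where "0 < c" "0 < C'"
    "\<And>f. f holomorphic_on \<H> \<Longrightarrow> orlicz_modular \<Phi>1 \<alpha> f \<le> 1 \<Longrightarrow>
      (\<integral>\<^sup>+w\<in>\<H>. ennreal (\<Phi>2 (c * norm (f w))) \<partial>\<mu>) \<le> ennreal C'"
proof -
  obtain c where c: "0 < c"
    and loc: "\<And>f w. f holomorphic_on \<H> \<Longrightarrow> w \<in> \<H> \<Longrightarrow> ennreal (\<Phi>1 (c * norm (f w))) \<le>
      ennreal (1 / Im w powr (2 + \<alpha>)) * (\<integral>\<^sup>+z\<in>square w (Im w / 2). ennreal (\<Phi>1 (norm (f z)) * Im z powr \<alpha>) \<partial>lborel)"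
    using P1.modular_local_estimate by blast
  obtain D where D: "0 < D" "\<And>v. 0 < v \<Longrightarrow> G v \<le> D * G (6 * v)" using G_dilation by blast
  interpret M: sigma_finite_measure M using C by (intro sigma_finite_M[of C]) auto
  interpret prod: pair_sigma_finite M lborel ..
  have "(\<integral>\<^sup>+w\<in>\<H>. ennreal (\<Phi>2 (c * norm (f w))) \<partial>\<mu>) \<le> ennreal (D * C)"
    if f: "f holomorphic_on \<H>" and mod: "orlicz_modular \<Phi>1 \<alpha> f \<le> 1" for f
  proof -
    define F where "F z = ennreal (\<Phi>1 (norm (f z)) * Im z powr \<alpha>) * indicator \<H> z" for z
    have [measurable]: "F \<in> borel_measurable borel"
      unfolding F_def by (rule P1.borel_measurable_modular_integrand[OF f])
    \<comment> \<open>Written with an indicator of a subset of the product and with the truncated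
      \<open>G\<close>, so that joint measurability is immediate; \<open>K_eq\<close> is the form
      used in estimates.\<close>
    define K where "K w z = F z * indicator {p. \<bar>Re (snd p) - Re (fst p)\<bar> \<le> Im (fst p) / 2 \<and> \<bar>Im (snd p) - Im (fst p)\<bar> \<le> Im (fst p) / 2} (w, z)
       * ennreal (D * (indicator {0<..} (4 * Im z) *\<^sub>R G (4 * Im z)))" for w z :: complex
    have Km [measurable]: "case_prod K \<in> borel_measurable (M \<Otimes>\<^sub>M lborel)"
      unfolding K_def by measurable
    have K_eq: "K w z = F z * indicator (square w (Im w / 2)) z * ennreal (D * G (4 * Im z))" for w z
      by (auto simp: K_def F_def indicator_def mem_square upper_half_plane_def)
    \<comment> \<open>After \<open>superlinear\<close> the weight is evaluated at Im w. It is moved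
      to 4 Im z inside the integral, so that it becomes constant when w is integrated.\<close>
    have pw: "ennreal (\<Phi>2 (c * norm (f w))) \<le> (\<integral>\<^sup>+z. K w z \<partial>lborel)" if w: "w \<in> \<H>" for w
    proof -
      have v: "0 < Im w" using w by (simp add: upper_half_plane_def)
      define m where "m = (\<integral>\<^sup>+z\<in>square w (Im w / 2). ennreal (\<Phi>1 (norm (f z)) * Im z powr \<alpha>) \<partial>lborel)"
      have "m \<le> 1" using P1.modular_square_le[OF w, of f \<alpha>] mod by (auto simp: m_def)
      then obtain m' where m': "m = ennreal m'" "0 \<le> m'" "m' \<le> 1"
        by (cases m) (auto simp: top_unique)
      have "\<Phi>1 (c * norm (f w)) \<le> m' * (1 / Im w powr (2 + \<alpha>))"
        using loc[OF f w, folded m_def] m' by (simp add: ennreal_mult[symmetric] mult.commute)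
      then have "\<Phi>2 (c * norm (f w)) \<le> m' * G (Im w)"
        unfolding G_def using c m' v by (intro superlinear) auto
      then have "ennreal (\<Phi>2 (c * norm (f w))) \<le> m * ennreal (G (Im w))"
        using m' G_pos[OF v] by (simp add: ennreal_mult[symmetric] ennreal_leI)
      also have "m = (\<integral>\<^sup>+z. F z * indicator (square w (Im w / 2)) z \<partial>lborel)"
        unfolding m_def F_def using square_subset_upper_half_plane[OF w]
        by (intro nn_integral_cong) (auto simp: indicator_def)
      also have "\<dots> * ennreal (G (Im w)) = (\<integral>\<^sup>+z. F z * indicator (square w (Im w / 2)) z * ennreal (G (Im w)) \<partial>lborel)"
        by (subst nn_integral_multc) auto
      also have "\<dots> \<le> (\<integral>\<^sup>+z. K w z \<partial>lborel)"
      proof (intro nn_integral_mono)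
        fix z
        show "F z * indicator (square w (Im w / 2)) z * ennreal (G (Im w)) \<le> K w z"
        proof (cases "z \<in> square w (Im w / 2)")
          case True
          \<comment> \<open>Here 4 Im z \<le> 6 Im w, so \<open>G_dilation\<close> followed by
            \<open>G_antimono\<close> applies.\<close>
          then have "0 < Im z" "Im z \<le> 3 / 2 * Im w" using v unfolding mem_square abs_le_iff by auto
          then have "G (Im w) \<le> D * G (4 * Im z)"
            using D(1) by (intro order_trans[OF D(2)[OF v]] mult_left_mono G_antimono) auto
          then show ?thesis unfolding K_eq by (intro mult_left_mono ennreal_leI) auto
        qed (simp add: K_eq)
      qed
      finally show ?thesis .
    qed
    have Kz: "(\<integral>\<^sup>+w. K w z \<partial>M) \<le> F z * ennreal (D * C)" for z
    proof (cases "z \<in> \<H>")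
      case True
      define y where "y = Im z"
      have y: "0 < y" using True by (simp add: y_def upper_half_plane_def)
      define S where "S = {w. z \<in> square w (Im w / 2)}"
      have [measurable]: "S \<in> sets borel" unfolding S_def mem_square by measurable
      have "(\<integral>\<^sup>+w. K w z \<partial>M) = (\<integral>\<^sup>+w. (F z * ennreal (D * G (4 * y))) * indicator S w \<partial>M)"
        by (intro nn_integral_cong) (auto simp: K_eq S_def y_def indicator_def)
      also have "\<dots> = F z * ennreal (D * G (4 * y)) * emeasure M S"
        by (subst nn_integral_cmult_indicator) auto
      also have "emeasure M S \<le> ennreal C / ennreal (G (4 * y))"
      proof -
        \<comment> \<open>If z is in the square around w, then Im w / 2 \<le> Im z = y, hence Im w
          \<le> 2y < 4y and |Re w - Re z| \<le> y. The interval is taken of length 4y so that its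
          box has height 4y as well.\<close>
        have "\<H> \<inter> S \<subseteq> carleson_box {Re z - 2 * y..Re z + 2 * y} (4 * y)"
          unfolding S_def mem_square carleson_box_def upper_half_plane_def y_def abs_le_iff by auto
        then have "emeasure M S \<le> emeasure \<mu> (carleson_box {Re z - 2 * y..Re z + 2 * y} (4 * y))"
          by (subst emeasure_M) (auto intro!: emeasure_mono)
        also have "\<dots> \<le> ennreal C / ennreal (G (4 * y))"
          using C(1)[unfolded carleson_def, rule_format, of "Re z - 2 * y" "Re z + 2 * y"] y by simp
        finally show ?thesis .
      qed
      also have "F z * ennreal (D * G (4 * y)) * (ennreal C / ennreal (G (4 * y))) = F z * ennreal (D * C)"
        using G_pos[of "4 * y"] y C D by (simp add: divide_ennreal ennreal_mult[symmetric] mult.assoc)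
      finally show ?thesis by (auto simp: mult_left_mono)
    qed (simp add: K_eq F_def)
    have "(\<integral>\<^sup>+w\<in>\<H>. ennreal (\<Phi>2 (c * norm (f w))) \<partial>\<mu>) \<le> (\<integral>\<^sup>+w\<in>\<H>. (\<integral>\<^sup>+z. K w z \<partial>lborel) \<partial>\<mu>)"
      using pw by (intro nn_integral_mono) (auto simp: indicator_def)
    also have "\<dots> = (\<integral>\<^sup>+w. \<integral>\<^sup>+z. K w z \<partial>lborel \<partial>M)"
      by (rule nn_integral_M[symmetric]) (use Km in measurable)
    also have "\<dots> = (\<integral>\<^sup>+z. \<integral>\<^sup>+w. K w z \<partial>M \<partial>lborel)"
      by (rule prod.Fubini'[symmetric, OF Km])
    also have "\<dots> \<le> (\<integral>\<^sup>+z. F z * ennreal (D * C) \<partial>lborel)"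
      by (intro nn_integral_mono Kz)
    also have "\<dots> = orlicz_modular \<Phi>1 \<alpha> f * ennreal (D * C)"
      by (subst nn_integral_multc) (auto simp: orlicz_modular_def F_def[symmetric])
    also have "\<dots> \<le> 1 * ennreal (D * C)" by (intro mult_right_mono mod) auto
    finally show ?thesis by simp
  qed
  then show ?thesis using that[of c "D * C"] c D C by simp
qed

end

section \<open>Test functions\<close>

lemma borel_measurable_cnj [measurable]: "cnj \<in> borel_measurable borel"
  by (intro borel_measurable_continuous_onI continuous_intros)

text \<open>The primitive is arctan(t/B)/B on the half-line, doubled by symmetry. The two closed
  half-lines overlap at 0, which only increases the upper estimate.\<close>

lemma nn_integral_Cauchy_density_le:
  assumes B: "0 < B"
  shows "(\<integral>\<^sup>+u. ennreal (1 / ((u - x)\<^sup>2 + B\<^sup>2)) \<partial>lborel) \<le> ennreal (pi / B)"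
proof -
  let ?f = "\<lambda>t. 1 / (t\<^sup>2 + B\<^sup>2)"
  have pos: "t\<^sup>2 + B\<^sup>2 > 0" for t using B by (simp add: add_nonneg_pos)
  have half: "(\<integral>\<^sup>+t. ennreal (?f t) * indicator {0..} t \<partial>lborel) = ennreal (pi / 2 / B - arctan (0 / B) / B)"
  proof (rule nn_integral_FTC_atLeast[where F = "\<lambda>t. arctan (t / B) / B"])
    have "filterlim (\<lambda>t. inverse B * t) at_top at_top"
      by (rule filterlim_tendsto_pos_mult_at_top[OF tendsto_const _ filterlim_ident]) (use B in auto)
    then have "filterlim (\<lambda>t. t / B) at_top at_top" by (simp add: divide_inverse mult.commute)
    then show "((\<lambda>t. arctan (t / B) / B) \<longlongrightarrow> pi / 2 / B) at_top"
      using B by (intro tendsto_divide tendsto_const filterlim_compose[OF tendsto_arctan_at_top]) auto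
    fix t :: real
    have "((\<lambda>t. arctan (t / B) / B) has_real_derivative (1 / B) * (1 / (1 + (t / B)\<^sup>2)) / B) (at t)"
      using B by (auto intro!: derivative_eq_intros simp: divide_inverse)
    also have "(1 / B) * (1 / (1 + (t / B)\<^sup>2)) / B = ?f t"
    proof -
      have "B\<^sup>2 * (1 + (t / B)\<^sup>2) = t\<^sup>2 + B\<^sup>2"
        using B by (simp add: field_simps power2_eq_square)
      moreover have "(1 / B) * (1 / q) / B = 1 / (B\<^sup>2 * q)" for q
        by (simp add: power2_eq_square)
      ultimately show ?thesis by (simp only:)
    qed
    finally show "((\<lambda>t. arctan (t / B) / B) has_real_derivative ?f t) (at t)" .
    show "0 \<le> ?f t" using pos[of t] by simp
  qed measurable
  have half': "(\<integral>\<^sup>+t. ennreal (?f t) * indicator {..0} t \<partial>lborel) = (\<integral>\<^sup>+t. ennreal (?f t) * indicator {0..} t \<partial>lborel)"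
  proof -
    have "(\<integral>\<^sup>+t. ennreal (?f t) * indicator {..0} t \<partial>lborel) = (\<integral>\<^sup>+t. ennreal (?f (- t)) * indicator {..0} (- t) \<partial>lborel)"
      using nn_integral_real_affine[of "\<lambda>t. ennreal (?f t) * indicator {..0} t" "-1" 0] by simp
    also have "\<dots> = (\<integral>\<^sup>+t. ennreal (?f t) * indicator {0..} t \<partial>lborel)"
      by (intro nn_integral_cong) (simp split: split_indicator)
    finally show ?thesis .
  qed
  have "(\<integral>\<^sup>+u. ennreal (1 / ((u - x)\<^sup>2 + B\<^sup>2)) \<partial>lborel) = (\<integral>\<^sup>+t. ennreal (?f t) \<partial>lborel)"
    using nn_integral_real_affine[of "\<lambda>u. ennreal (1 / ((u - x)\<^sup>2 + B\<^sup>2))" 1 x] by simp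
  also have "\<dots> \<le> (\<integral>\<^sup>+t. ennreal (?f t) * indicator {0..} t + ennreal (?f t) * indicator {..0} t \<partial>lborel)"
    by (intro nn_integral_mono) (simp split: split_indicator)
  also have "\<dots> = (\<integral>\<^sup>+t. ennreal (?f t) * indicator {0..} t \<partial>lborel) + (\<integral>\<^sup>+t. ennreal (?f t) * indicator {..0} t \<partial>lborel)"
    by (intro nn_integral_add) auto
  also have "\<dots> = ennreal (pi / B)"
    unfolding half' half using B by (simp add: ennreal_plus[symmetric] del: ennreal_plus)
  finally show ?thesis .
qed

text \<open>The exponent 4 + 2\<alpha> is split as (2 + 2\<alpha>) + 2. The first part is bounded
  through the height y + v, and the second leaves a Cauchy density in the horizontal variable. The
  remaining integral in v converges at 0 because \<alpha> > -1 and at infinity because its integrand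
  is at most a multiple of v^(-3-\<alpha>).\<close>

lemma kernel_integral:
  assumes alpha: "-1 < \<alpha>"
  obtains C where "1 \<le> C"
    "\<And>z. z \<in> \<H> \<Longrightarrow> (\<integral>\<^sup>+w\<in>\<H>. ennreal (Im z powr (4 + 2 * \<alpha>) / cmod (z - cnj w) powr (4 + 2 * \<alpha>) * Im w powr \<alpha>) \<partial>lborel)
       \<le> ennreal (C * Im z powr (2 + \<alpha>))"
proof -
  \<comment> \<open>The two quotients come from the ranges v \<le> y and v \<ge> y; adding 1 secures
    \<open>1 \<le> C\<close>, which dividing a modular by C requires.\<close>
  define C where "C = pi / (1 + \<alpha>) + pi / (2 + \<alpha>) + 1"
  have C: "1 \<le> C" using alpha by (simp add: C_def)
  have "(\<integral>\<^sup>+w\<in>\<H>. ennreal (Im z powr (4 + 2 * \<alpha>) / cmod (z - cnj w) powr (4 + 2 * \<alpha>) * Im w powr \<alpha>) \<partial>lborel)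
       \<le> ennreal (C * Im z powr (2 + \<alpha>))" if z: "z \<in> \<H>" for z
  proof -
    define x y where "x = Re z" and "y = Im z"
    have y: "0 < y" using z by (simp add: y_def upper_half_plane_def)
    \<comment> \<open>The distance is at least y + v, and 2 + 2\<alpha> is positive, so only the
      square of the distance is kept exact.\<close>
    have dist: "(y + v) powr (2 + 2 * \<alpha>) * ((u - x)\<^sup>2 + (y + v)\<^sup>2) \<le> cmod (z - cnj (Complex u v)) powr (4 + 2 * \<alpha>)"
      if v: "0 < v" for u v
    proof -
      let ?d = "cmod (z - cnj (Complex u v))"
      have d2: "?d\<^sup>2 = (u - x)\<^sup>2 + (y + v)\<^sup>2"
        by (simp add: cmod_power2 x_def y_def power2_commute)
      have dB: "y + v \<le> ?d" using abs_Im_le_cmod[of "z - cnj (Complex u v)"] by (simp add: y_def)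
      have "(y + v) powr (2 + 2 * \<alpha>) * ((u - x)\<^sup>2 + (y + v)\<^sup>2) \<le> ?d powr (2 + 2 * \<alpha>) * ?d\<^sup>2"
        unfolding d2 using alpha y v dB by (intro mult_right_mono powr_mono2) auto
      also have "\<dots> = ?d powr (4 + 2 * \<alpha>)"
        using dB y v by (simp add: powr_add powr_numeral mult.commute power2_eq_square power4_eq_xxxx mult.assoc)
      finally show ?thesis .
    qed
    have inner: "(\<integral>\<^sup>+u. ennreal (y powr (4 + 2 * \<alpha>) / cmod (z - cnj (Complex u v)) powr (4 + 2 * \<alpha>) * v powr \<alpha>) \<partial>lborel)
        \<le> ennreal (pi * y powr (4 + 2 * \<alpha>) * v powr \<alpha> / (y + v) powr (3 + 2 * \<alpha>))" (is "?L \<le> _")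
      if v: "0 < v" for v
    proof -
      define k where "k = y powr (4 + 2 * \<alpha>) * v powr \<alpha> / (y + v) powr (2 + 2 * \<alpha>)"
      have k: "k \<ge> 0" by (simp add: k_def)
      have "?L \<le> (\<integral>\<^sup>+u. ennreal k * ennreal (1 / ((u - x)\<^sup>2 + (y + v)\<^sup>2)) \<partial>lborel)"
      proof (intro nn_integral_mono)
        fix u
        have p: "0 < (y + v) powr (2 + 2 * \<alpha>) * ((u - x)\<^sup>2 + (y + v)\<^sup>2)"
          using y v by (intro mult_pos_pos) (auto simp: add_nonneg_pos)
        have "y powr (4 + 2 * \<alpha>) * v powr \<alpha> / cmod (z - cnj (Complex u v)) powr (4 + 2 * \<alpha>)
          \<le> y powr (4 + 2 * \<alpha>) * v powr \<alpha> / ((y + v) powr (2 + 2 * \<alpha>) * ((u - x)\<^sup>2 + (y + v)\<^sup>2))"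
          using dist[OF v, of u] p by (intro frac_le) auto
        then show "ennreal (y powr (4 + 2 * \<alpha>) / cmod (z - cnj (Complex u v)) powr (4 + 2 * \<alpha>) * v powr \<alpha>)
           \<le> ennreal k * ennreal (1 / ((u - x)\<^sup>2 + (y + v)\<^sup>2))"
          using k by (subst ennreal_mult'[symmetric]) (auto simp: k_def intro!: ennreal_leI)
      qed
      also have "\<dots> = ennreal k * (\<integral>\<^sup>+u. ennreal (1 / ((u - x)\<^sup>2 + (y + v)\<^sup>2)) \<partial>lborel)"
        by (rule nn_integral_cmult) simp
      also have "\<dots> \<le> ennreal k * ennreal (pi / (y + v))"
        using y v by (intro mult_left_mono nn_integral_Cauchy_density_le) auto
      also have "\<dots> = ennreal (k * (pi / (y + v)))"
        using k by (rule ennreal_mult'[symmetric])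
      also have "k * (pi / (y + v)) = pi * y powr (4 + 2 * \<alpha>) * v powr \<alpha> / (y + v) powr (3 + 2 * \<alpha>)"
      proof -
        have "(y + v) powr (3 + 2 * \<alpha>) = (y + v) powr (2 + 2 * \<alpha>) * (y + v) powr 1"
          by (subst powr_add[symmetric]) (simp add: algebra_simps)
        then show ?thesis using y v by (simp add: k_def)
      qed
      finally show ?thesis .
    qed
    \<comment> \<open>Cut at v = y: below, y + v is replaced by y, above by v. The closed ranges
      overlap at v = y, which an upper bound tolerates.\<close>
    have outer: "ennreal (pi * y powr (4 + 2 * \<alpha>) * v powr \<alpha> / (y + v) powr (3 + 2 * \<alpha>)) * indicator {0<..} v
      \<le> ennreal (pi * y) * (ennreal (v powr \<alpha>) * indicator {0..y} v)
        + ennreal (pi * y powr (4 + 2 * \<alpha>)) * (ennreal (v powr (-3 - \<alpha>)) * indicator {y..} v)" for v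
    proof -
      consider "v \<le> 0" | "0 < v" "v \<le> y" | "y < v" by linarith
      then show ?thesis
      proof cases
        case 2
        have "y powr (4 + 2 * \<alpha>) = y * y powr (3 + 2 * \<alpha>)"
          using y powr_add[of y 1 "3 + 2 * \<alpha>"] by simp
        moreover have "y powr (3 + 2 * \<alpha>) \<le> (y + v) powr (3 + 2 * \<alpha>)"
          using alpha y 2 by (intro powr_mono2) auto
        ultimately have "pi * y powr (4 + 2 * \<alpha>) * v powr \<alpha> / (y + v) powr (3 + 2 * \<alpha>) \<le> pi * y * v powr \<alpha>"
          using y 2 by (simp add: divide_le_eq mult_left_mono mult.commute mult.left_commute)
        then have "ennreal (pi * y powr (4 + 2 * \<alpha>) * v powr \<alpha> / (y + v) powr (3 + 2 * \<alpha>)) \<le> ennreal (pi * y) * ennreal (v powr \<alpha>)"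
          using y by (subst ennreal_mult'[symmetric]) (auto intro: ennreal_leI)
        then show ?thesis using 2 by (auto simp: indicator_def intro: add_increasing2)
      next
        case 3
        have "v powr (3 + 2 * \<alpha>) \<le> (y + v) powr (3 + 2 * \<alpha>)"
          using alpha y 3 by (intro powr_mono2) auto
        then have "v powr \<alpha> / (y + v) powr (3 + 2 * \<alpha>) \<le> v powr \<alpha> / v powr (3 + 2 * \<alpha>)"
          using y 3 by (intro divide_left_mono) auto
        also have "\<dots> = v powr (-3 - \<alpha>)"
        proof -
          have "\<alpha> - (3 + 2 * \<alpha>) = -3 - \<alpha>" by simp
          then show ?thesis using powr_diff[of v \<alpha> "3 + 2 * \<alpha>"] by (simp only:)
        qed
        finally have "pi * y powr (4 + 2 * \<alpha>) * (v powr \<alpha> / (y + v) powr (3 + 2 * \<alpha>)) \<le> pi * y powr (4 + 2 * \<alpha>) * v powr (-3 - \<alpha>)"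
          by (intro mult_left_mono) auto
        then have "ennreal (pi * y powr (4 + 2 * \<alpha>) * v powr \<alpha> / (y + v) powr (3 + 2 * \<alpha>)) \<le> ennreal (pi * y powr (4 + 2 * \<alpha>)) * ennreal (v powr (-3 - \<alpha>))"
          by (subst ennreal_mult'[symmetric]) (auto intro: ennreal_leI)
        then show ?thesis using 3 y by (auto simp: indicator_def)
      qed auto
    qed
    have "(\<integral>\<^sup>+w\<in>\<H>. ennreal (y powr (4 + 2 * \<alpha>) / cmod (z - cnj w) powr (4 + 2 * \<alpha>) * Im w powr \<alpha>) \<partial>lborel)
       = (\<integral>\<^sup>+v. \<integral>\<^sup>+u. ennreal (y powr (4 + 2 * \<alpha>) / cmod (z - cnj (Complex u v)) powr (4 + 2 * \<alpha>) * v powr \<alpha>) * indicator {0<..} v \<partial>lborel \<partial>lborel)"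
    proof -
      have [measurable]: "(\<lambda>w. ennreal (y powr (4 + 2 * \<alpha>) / cmod (z - cnj w) powr (4 + 2 * \<alpha>) * Im w powr \<alpha>) * indicator \<H> w) \<in> borel_measurable borel"
        by measurable
      show ?thesis
        by (subst nn_integral_complex_iterated'[of "\<lambda>w. ennreal (y powr (4 + 2 * \<alpha>) / cmod (z - cnj w) powr (4 + 2 * \<alpha>) * Im w powr \<alpha>) * indicator \<H> w"])
          (simp_all add: upper_half_plane_def indicator_def)
    qed
    also have "\<dots> = (\<integral>\<^sup>+v. (\<integral>\<^sup>+u. ennreal (y powr (4 + 2 * \<alpha>) / cmod (z - cnj (Complex u v)) powr (4 + 2 * \<alpha>) * v powr \<alpha>) \<partial>lborel) * indicator {0<..} v \<partial>lborel)"
      by (intro nn_integral_cong nn_integral_multc) measurable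
    also have "\<dots> \<le> (\<integral>\<^sup>+v. ennreal (pi * y powr (4 + 2 * \<alpha>) * v powr \<alpha> / (y + v) powr (3 + 2 * \<alpha>)) * indicator {0<..} v \<partial>lborel)"
      using inner by (intro nn_integral_mono) (auto simp: indicator_def)
    also have "\<dots> \<le> (\<integral>\<^sup>+v. ennreal (pi * y) * (ennreal (v powr \<alpha>) * indicator {0..y} v)
        + ennreal (pi * y powr (4 + 2 * \<alpha>)) * (ennreal (v powr (-3 - \<alpha>)) * indicator {y..} v) \<partial>lborel)"
      by (intro nn_integral_mono outer)
    also have "\<dots> = ennreal (pi * y) * (\<integral>\<^sup>+v\<in>{0..y}. ennreal (v powr \<alpha>) \<partial>lborel)
        + ennreal (pi * y powr (4 + 2 * \<alpha>)) * (\<integral>\<^sup>+v\<in>{y..}. ennreal (v powr (-3 - \<alpha>)) \<partial>lborel)"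
      by (simp add: nn_integral_add nn_integral_cmult)
    also have "(\<integral>\<^sup>+v\<in>{0..y}. ennreal (v powr \<alpha>) \<partial>lborel) = ennreal (y powr (\<alpha> + 1) / (\<alpha> + 1))"
      using alpha y by (intro nn_integral_has_integral_lebesgue' has_integral_powr_from_0) auto
    also have "(\<integral>\<^sup>+v\<in>{y..}. ennreal (v powr (-3 - \<alpha>)) \<partial>lborel) = ennreal (- (y powr (-3 - \<alpha> + 1)) / (-3 - \<alpha> + 1))"
      using alpha y by (intro nn_integral_has_integral_lebesgue' has_integral_powr_to_inf) auto
    also have "- (y powr (-3 - \<alpha> + 1)) / (-3 - \<alpha> + 1) = y powr (-2 - \<alpha>) / (2 + \<alpha>)"
      using alpha by (simp add: field_simps)
    also have "ennreal (pi * y) * ennreal (y powr (\<alpha> + 1) / (\<alpha> + 1)) + ennreal (pi * y powr (4 + 2 * \<alpha>)) * ennreal (y powr (-2 - \<alpha>) / (2 + \<alpha>))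
      = ennreal (pi * y * (y powr (\<alpha> + 1) / (\<alpha> + 1)) + pi * y powr (4 + 2 * \<alpha>) * (y powr (-2 - \<alpha>) / (2 + \<alpha>)))"
    proof -
      have "ennreal a * ennreal b + ennreal c * ennreal d = ennreal (a * b + c * d)"
        if "0 \<le> a" "0 \<le> b" "0 \<le> c" "0 \<le> d" for a b c d
        using that by (simp add: ennreal_mult ennreal_plus)
      note fold = this
      show ?thesis using alpha y by (intro fold) auto
    qed
    also have "\<dots> \<le> ennreal (C * y powr (2 + \<alpha>))"
    proof (rule ennreal_leI)
      have *: "y * y powr (\<alpha> + 1) = y powr (2 + \<alpha>)"
        using y powr_add[of y 1 "\<alpha> + 1"] by (simp add: algebra_simps)
      have **: "y powr (4 + 2 * \<alpha>) * y powr (-2 - \<alpha>) = y powr (2 + \<alpha>)"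
        using powr_add[of y "4 + 2 * \<alpha>" "-2 - \<alpha>"] by (simp add: algebra_simps)
      have "pi * y * (y powr (\<alpha> + 1) / (\<alpha> + 1)) + pi * y powr (4 + 2 * \<alpha>) * (y powr (-2 - \<alpha>) / (2 + \<alpha>))
          = pi * (y * y powr (\<alpha> + 1)) / (\<alpha> + 1) + pi * (y powr (4 + 2 * \<alpha>) * y powr (-2 - \<alpha>)) / (2 + \<alpha>)"
        by simp
      also have "\<dots> = pi * y powr (2 + \<alpha>) / (\<alpha> + 1) + pi * y powr (2 + \<alpha>) / (2 + \<alpha>)"
        by (simp only: * **)
      also have "\<dots> \<le> C * y powr (2 + \<alpha>)" by (simp add: C_def algebra_simps)
      finally show "pi * y * (y powr (\<alpha> + 1) / (\<alpha> + 1)) + pi * y powr (4 + 2 * \<alpha>) * (y powr (-2 - \<alpha>) / (2 + \<alpha>)) \<le> C * y powr (2 + \<alpha>)" .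
    qed
    finally show ?thesis by (simp add: y_def)
  qed
  with C show ?thesis by (rule that)
qed

section \<open>Powers of the half-plane Bergman kernel as test functions\<close>

context young
begin

text \<open>The modulus is the argument of \<open>\<Phi>2\<close> in (b). For z and w in the
  half-plane, w - cnj z lies there too, and the factor -i turns it into the right half-plane, where
  the principal branch of the power is holomorphic.\<close>

definition test_fun :: "real \<Rightarrow> complex \<Rightarrow> complex \<Rightarrow> complex" where
  "test_fun \<alpha> z w = of_real (growth_inv \<Phi> (1 / Im z powr (2 + \<alpha>)) * Im z powr (4 + 2 * \<alpha>)) /
     (- \<i> * (w - cnj z)) powr of_real (4 + 2 * \<alpha>)"

lemma test_fun_holomorphic:
  assumes "z \<in> \<H>" shows "test_fun \<alpha> z holomorphic_on \<H>"
proof -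
  have nonpos: "- \<i> * (w - cnj z) \<notin> \<real>\<^sub>\<le>\<^sub>0" if "w \<in> \<H>" for w
    using that assms by (auto simp: complex_nonpos_Reals_iff upper_half_plane_def)
  have "(\<lambda>w. of_real (growth_inv \<Phi> (1 / Im z powr (2 + \<alpha>)) * Im z powr (4 + 2 * \<alpha>)) /
     exp (of_real (4 + 2 * \<alpha>) * Ln (- \<i> * (w - cnj z)))) holomorphic_on \<H>"
    by (intro holomorphic_intros nonpos) auto
  then show ?thesis
  proof (rule holomorphic_transform)
    \<comment> \<open>Complex \<open>powr\<close> treats base 0 separately; the base avoids 0 here,
      so it agrees with the exponential form.\<close>
    fix w assume "w \<in> \<H>"
    then have "- \<i> * (w - cnj z) \<noteq> 0" using nonpos by (metis nonpos_Reals_zero_I)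
    then show "of_real (growth_inv \<Phi> (1 / Im z powr (2 + \<alpha>)) * Im z powr (4 + 2 * \<alpha>)) /
       exp (of_real (4 + 2 * \<alpha>) * Ln (- \<i> * (w - cnj z))) = test_fun \<alpha> z w"
      unfolding test_fun_def powr_def by (simp only: if_False)
  qed
qed

lemma norm_test_fun:
  "norm (test_fun \<alpha> z w) = growth_inv \<Phi> (1 / Im z powr (2 + \<alpha>)) * Im z powr (4 + 2 * \<alpha>) / cmod (z - cnj w) powr (4 + 2 * \<alpha>)"
proof -
  have "cmod (w - cnj z) = cmod (z - cnj w)"
    using complex_mod_cnj[of "w - cnj z"] by (simp add: norm_minus_commute)
  then show ?thesis
    by (simp add: test_fun_def norm_divide norm_mult norm_powr_real_powr' inv_nonneg)
qed

text \<open>Since |z - cnj w| \<ge> Im z, the kernel quotient r is at most 1, and convexity gives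
  \<Phi>(r u) \<le> r \<Phi>(u) with \<Phi>(u) = (Im z)^(-2-\<alpha>). This factor cancels exactly
  the growth of \<open>kernel_integral\<close>, so the bound is independent of z.\<close>

lemma test_fun_modular:
  assumes "-1 < \<alpha>"
  obtains C where "1 \<le> C" "\<And>z. z \<in> \<H> \<Longrightarrow> orlicz_modular \<Phi> \<alpha> (test_fun \<alpha> z) \<le> ennreal C"
proof -
  obtain C where C: "1 \<le> C"
    "\<And>z. z \<in> \<H> \<Longrightarrow> (\<integral>\<^sup>+w\<in>\<H>. ennreal (Im z powr (4 + 2 * \<alpha>) / cmod (z - cnj w) powr (4 + 2 * \<alpha>) * Im w powr \<alpha>) \<partial>lborel)
       \<le> ennreal (C * Im z powr (2 + \<alpha>))"
    using kernel_integral[OF assms] by blast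
  have "orlicz_modular \<Phi> \<alpha> (test_fun \<alpha> z) \<le> ennreal C" if z: "z \<in> \<H>" for z
  proof -
    define y s where "y = Im z" and "s = 1 / y powr (2 + \<alpha>)"
    have y: "0 < y" using z by (simp add: y_def upper_half_plane_def)
    have s: "0 < s" using y by (simp add: s_def)
    define r where "r w = y powr (4 + 2 * \<alpha>) / cmod (z - cnj w) powr (4 + 2 * \<alpha>)" for w
    have "orlicz_modular \<Phi> \<alpha> (test_fun \<alpha> z) \<le> (\<integral>\<^sup>+w. ennreal s * (ennreal (r w * Im w powr \<alpha>) * indicator \<H> w) \<partial>lborel)"
      unfolding orlicz_modular_def
    proof (intro nn_integral_mono)
      fix w
      show "ennreal (\<Phi> (cmod (test_fun \<alpha> z w)) * Im w powr \<alpha>) * indicator \<H> w \<le> ennreal s * (ennreal (r w * Im w powr \<alpha>) * indicator \<H> w)"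
      proof (cases "w \<in> \<H>")
        case True
        have "y \<le> cmod (z - cnj w)"
          using abs_Im_le_cmod[of "z - cnj w"] True y by (simp add: y_def upper_half_plane_def)
        then have "y powr (4 + 2 * \<alpha>) \<le> cmod (z - cnj w) powr (4 + 2 * \<alpha>)"
          using y assms by (intro powr_mono2) auto
        then have r: "0 \<le> r w" "r w \<le> 1"
          unfolding r_def by (simp, subst divide_le_eq_1_pos) (use y in \<open>auto intro: less_le_trans[of 0 "y powr _"]\<close>)
        have "\<Phi> (cmod (test_fun \<alpha> z w)) = \<Phi> (r w * growth_inv \<Phi> s)"
          unfolding norm_test_fun r_def y_def s_def by (simp add: mult.commute)
        also have "\<dots> \<le> r w * s"
          using scale_le[OF r, of "growth_inv \<Phi> s"] s by (simp add: inv_nonneg inv_eq)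
        finally have "\<Phi> (cmod (test_fun \<alpha> z w)) * Im w powr \<alpha> \<le> r w * s * Im w powr \<alpha>"
          by (rule mult_right_mono) simp
        then have "ennreal (\<Phi> (cmod (test_fun \<alpha> z w)) * Im w powr \<alpha>) \<le> ennreal (s * (r w * Im w powr \<alpha>))"
          by (intro ennreal_leI) (simp add: mult_ac)
        also have "\<dots> = ennreal s * ennreal (r w * Im w powr \<alpha>)"
          by (rule ennreal_mult') (use s in auto)
        finally show ?thesis using True by simp
      qed simp
    qed
    also have "\<dots> = ennreal s * (\<integral>\<^sup>+w\<in>\<H>. ennreal (r w * Im w powr \<alpha>) \<partial>lborel)"
      unfolding r_def by (rule nn_integral_cmult) measurable
    also have "\<dots> \<le> ennreal s * ennreal (C * y powr (2 + \<alpha>))"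
      using C(2)[OF z] unfolding r_def y_def by (intro mult_left_mono) auto
    also have "\<dots> = ennreal (s * (C * y powr (2 + \<alpha>)))"
      by (rule ennreal_mult'[symmetric]) (use s in auto)
    also have "s * (C * y powr (2 + \<alpha>)) = C"
      using y by (simp add: s_def)
    finally show ?thesis .
  qed
  with C(1) show ?thesis by (rule that)
qed

end

section \<open>Series in the Bergman--Orlicz space and uniform boundedness\<close>

lemma sums_half_powers: "(\<lambda>n. (1 / 2) ^ Suc n :: real) sums 1"
  using power_half_series by simp

context young
begin

text \<open>The support line turns the weights (1/2)^(n+1), which sum to 1, into a countable Jensen inequality.\<close>

lemma half_powers_jensen:
  assumes a: "\<And>n. 0 \<le> a n" "\<And>n. a n \<le> B"
  shows "summable (\<lambda>n. (1 / 2) ^ Suc n * \<Phi> (a n))"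
    and "\<Phi> (\<Sum>n. (1 / 2) ^ Suc n * a n) \<le> (\<Sum>n. (1 / 2) ^ Suc n * \<Phi> (a n))"
proof -
  have summ: "summable (\<lambda>n. (1 / 2) ^ Suc n * b n)" if "\<And>n. 0 \<le> b n" "\<And>n. b n \<le> K" for b :: "nat \<Rightarrow> real" and K
    using that by (intro summable_comparison_test'[OF summable_mult2[OF sums_summable[OF sums_half_powers], of K]])
      (auto simp: abs_mult intro!: mult_left_mono)
  have "\<Phi> (a n) \<le> \<Phi> B" for n using a mono by auto
  then show s: "summable (\<lambda>n. (1 / 2) ^ Suc n * \<Phi> (a n))"
    using a nonneg by (intro summ) auto
  have sa: "summable (\<lambda>n. (1 / 2) ^ Suc n * a n)" using a by (intro summ) auto
  define t where "t = (\<Sum>n. (1 / 2) ^ Suc n * a n)"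
  have "t \<ge> 0" unfolding t_def using a by (intro suminf_nonneg sa) auto
  then obtain m where m: "\<And>x. 0 \<le> x \<Longrightarrow> \<Phi> t + m * (x - t) \<le> \<Phi> x" using support_line by blast
  \<comment> \<open>Sums the support line at \<open>t\<close> with the weights. As the weights add
    up to 1 and the weighted mean is \<open>t\<close>, the slope terms cancel and exactly \<Phi>(t)
    remains.\<close>
  have "(\<lambda>n. (1 / 2) ^ Suc n * (\<Phi> t - m * t) + m * ((1 / 2) ^ Suc n * a n)) sums (1 * (\<Phi> t - m * t) + m * t)"
    unfolding t_def by (intro sums_add sums_mult sums_mult2 sums_half_powers summable_sums sa)
  then have eq: "\<Phi> t = (\<Sum>n. (1 / 2) ^ Suc n * (\<Phi> t - m * t) + m * ((1 / 2) ^ Suc n * a n))"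
    and sm: "summable (\<lambda>n. (1 / 2) ^ Suc n * (\<Phi> t - m * t) + m * ((1 / 2) ^ Suc n * a n))"
    by (auto simp: sums_iff)
  have le: "(1 / 2) ^ Suc n * (\<Phi> t - m * t) + m * ((1 / 2) ^ Suc n * a n) \<le> (1 / 2) ^ Suc n * \<Phi> (a n)" for n
  proof -
    have "p * (x - m * t) + m * (p * y) = p * (x + m * (y - t))" for p x y :: real
      by (simp add: algebra_simps)
    then show ?thesis using m a by (simp only:) (intro mult_left_mono, auto)
  qed
  show "\<Phi> (\<Sum>n. (1 / 2) ^ Suc n * a n) \<le> (\<Sum>n. (1 / 2) ^ Suc n * \<Phi> (a n))"
    unfolding t_def[symmetric] by (subst eq) (rule suminf_le[OF le sm s])
qed

lemma borel_measurable_young_holomorphic: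
  assumes "f holomorphic_on \<H>" "0 \<le> c"
  shows "(\<lambda>z. ennreal (\<Phi> (c * norm (f z))) * indicator \<H> z) \<in> borel_measurable borel"
proof -
  note [measurable] = borel_measurable_holomorphic_indicator[OF assms(1)]
  have [measurable]: "(\<lambda>z. \<Phi> (c * (norm (f z) * indicator \<H> z))) \<in> borel_measurable borel"
    by (rule borel_measurable_comp, measurable) (use assms(2) in auto)
  have "(\<lambda>z. ennreal (\<Phi> (c * (norm (f z) * indicator \<H> z))) * indicator \<H> z) \<in> borel_measurable borel"
    by measurable
  then show ?thesis
    by (rule measurable_cong[THEN iffD1, rotated]) (auto simp: indicator_def)
qed

lemma modular_mono:
  assumes "\<And>z. z \<in> \<H> \<Longrightarrow> norm (f z) \<le> norm (g z)"
  shows "orlicz_modular \<Phi> \<alpha> f \<le> orlicz_modular \<Phi> \<alpha> g"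
  unfolding orlicz_modular_def using assms
  by (intro nn_integral_mono) (auto simp: indicator_def intro!: ennreal_leI mult_right_mono mono)

text \<open>Convexity converts scaling of the function into scaling of the modular, so a finite
  modular can be normalised to at most 1.\<close>

lemma modular_divide:
  assumes f: "f holomorphic_on \<H>" and r: "1 \<le> r"
  shows "orlicz_modular \<Phi> \<alpha> (\<lambda>z. f z / of_real r) \<le> ennreal (1 / r) * orlicz_modular \<Phi> \<alpha> f"
proof -
  have "orlicz_modular \<Phi> \<alpha> (\<lambda>z. f z / of_real r)
      \<le> (\<integral>\<^sup>+z. ennreal (1 / r) * (ennreal (\<Phi> (norm (f z)) * Im z powr \<alpha>) * indicator \<H> z) \<partial>lborel)"
    unfolding orlicz_modular_def
  proof (intro nn_integral_mono)
    fix z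
    have "\<Phi> (norm (f z / of_real r)) = \<Phi> (1 / r * norm (f z))"
      using r by (simp add: norm_divide)
    also have "\<dots> \<le> 1 / r * \<Phi> (norm (f z))" using r by (intro scale_le) auto
    finally have "\<Phi> (norm (f z / of_real r)) * Im z powr \<alpha> \<le> 1 / r * \<Phi> (norm (f z)) * Im z powr \<alpha>"
      by (rule mult_right_mono) simp
    then have "ennreal (\<Phi> (norm (f z / of_real r)) * Im z powr \<alpha>) \<le> ennreal (1 / r * (\<Phi> (norm (f z)) * Im z powr \<alpha>))"
      by (intro ennreal_leI) (simp add: mult.assoc)
    also have "\<dots> = ennreal (1 / r) * ennreal (\<Phi> (norm (f z)) * Im z powr \<alpha>)"
      by (rule ennreal_mult') (use r in auto)
    finally show "ennreal (\<Phi> (norm (f z / of_real r)) * Im z powr \<alpha>) * indicator \<H> z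
      \<le> ennreal (1 / r) * (ennreal (\<Phi> (norm (f z)) * Im z powr \<alpha>) * indicator \<H> z)"
      by (simp split: split_indicator)
  qed
  also have "\<dots> = ennreal (1 / r) * orlicz_modular \<Phi> \<alpha> f"
    unfolding orlicz_modular_def using borel_measurable_modular_integrand[OF f]
    by (intro nn_integral_cmult) auto
  finally show ?thesis .
qed

text \<open>The coefficients are pulled out by \<open>dilation\<close>, countable Jensen then bounds
  the integrand by the weighted integrands of the \<open>g n\<close>, and integrating termwise costs
  a total weight of 1. Holomorphy follows from the Weierstrass test on discs, with the pointwise
  bound as majorant.\<close>

lemma modular_half_powers_series:
  assumes g: "\<And>n. g n holomorphic_on \<H>" "\<And>n. orlicz_modular \<Phi> \<alpha> (g n) \<le> 1"
    and T: "\<And>n. norm (t n) \<le> T"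
  defines "S \<equiv> \<lambda>w. \<Sum>n. t n * (1 / 2) ^ Suc n * g n w"
  shows "S holomorphic_on \<H>" and "orlicz_modular \<Phi> \<alpha> S < \<infinity>"
proof -
  obtain c where c: "0 < c" and bound: "\<And>f w. f holomorphic_on \<H> \<Longrightarrow> orlicz_modular \<Phi> \<alpha> f \<le> 1 \<Longrightarrow> w \<in> \<H> \<Longrightarrow>
      norm (f w) \<le> c * growth_inv \<Phi> (1 / Im w powr (2 + \<alpha>))"
    using modular_pointwise_bound by blast
  define K where "K w = c * growth_inv \<Phi> (1 / Im w powr (2 + \<alpha>))" for w
  have gK: "norm (g n w) \<le> K w" if "w \<in> \<H>" for n w
    using bound g that by (simp add: K_def)
  have T0: "0 \<le> T" using T[of 0] norm_ge_zero order_trans by blast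
  have term_le: "norm (t n * (1 / 2) ^ Suc n * g n w) \<le> T * ((1 / 2) ^ Suc n * norm (g n w))" for n w
    using mult_right_mono[OF T[of n], of "(1 / 2) ^ Suc n * norm (g n w)"]
    by (simp add: norm_mult norm_power norm_divide mult.assoc)
  show hol: "S holomorphic_on \<H>"
  proof (rule holomorphic_uniform_sequence[OF open_upper_half_plane])
    show "(\<lambda>w. \<Sum>i<n. t i * (1 / 2) ^ Suc i * g i w) holomorphic_on \<H>" for n
      by (intro holomorphic_intros g)
    fix x assume x: "x \<in> \<H>"
    define y where "y = Im x / 2"
    have y: "0 < y" using x by (simp add: y_def upper_half_plane_def)
    have Im: "y \<le> Im w" if "w \<in> cball x y" for w
      using that abs_Im_le_cmod[of "x - w"] by (simp add: y_def dist_norm)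
    have sub: "cball x y \<subseteq> \<H>"
      using Im y by (force simp: upper_half_plane_def)
    \<comment> \<open>On the disc of radius y around x, heights range over [y, 3y]. The sign of 2 +
      \<alpha> is not fixed in this context, so the majorant takes the larger of the two endpoint
      values.\<close>
    define L where "L = c * growth_inv \<Phi> (max (1 / y powr (2 + \<alpha>)) (1 / (3 * y) powr (2 + \<alpha>)))"
    have Im3: "Im w \<le> 3 * y" if "w \<in> cball x y" for w
      using that abs_Im_le_cmod[of "x - w"] by (simp add: y_def dist_norm)
    have KL: "K w \<le> L" if w: "w \<in> cball x y" for w
    proof -
      have "1 / Im w powr (2 + \<alpha>) \<le> max (1 / y powr (2 + \<alpha>)) (1 / (3 * y) powr (2 + \<alpha>))"
      proof (cases "0 \<le> 2 + \<alpha>")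
        case True
        then have "y powr (2 + \<alpha>) \<le> Im w powr (2 + \<alpha>)" using Im[OF w] y by (intro powr_mono2) auto
        then have "1 / Im w powr (2 + \<alpha>) \<le> 1 / y powr (2 + \<alpha>)" using y Im[OF w] by (intro divide_left_mono) auto
        then show ?thesis by simp
      next
        case False
        then have "(3 * y) powr (2 + \<alpha>) \<le> Im w powr (2 + \<alpha>)" using Im[OF w] Im3[OF w] y by (intro powr_mono2') auto
        then have "1 / Im w powr (2 + \<alpha>) \<le> 1 / (3 * y) powr (2 + \<alpha>)" using y Im[OF w] by (intro divide_left_mono) auto
        then show ?thesis by simp
      qed
      then have "K w \<le> c * growth_inv \<Phi> (max (1 / y powr (2 + \<alpha>)) (1 / (3 * y) powr (2 + \<alpha>)))"
        unfolding K_def using c by (intro mult_left_mono inv_mono) auto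
      then show ?thesis by (simp add: L_def)
    qed
    have "uniform_limit (cball x y) (\<lambda>n w. \<Sum>i<n. t i * (1 / 2) ^ Suc i * g i w) S sequentially"
      unfolding S_def
    proof (rule Weierstrass_m_test)
      show "summable (\<lambda>n. T * ((1 / 2) ^ Suc n * L))"
        by (intro summable_mult summable_mult2 sums_summable[OF sums_half_powers])
      fix n w assume w: "w \<in> cball x y"
      have "norm (g n w) \<le> L" using gK[of w n] KL[OF w] w sub by fastforce
      then show "norm (t n * (1 / 2) ^ Suc n * g n w) \<le> T * ((1 / 2) ^ Suc n * L)"
        using T0 by (intro order_trans[OF term_le] mult_left_mono) auto
    qed
    then show "\<exists>d>0. cball x d \<subseteq> \<H> \<and> uniform_limit (cball x d) (\<lambda>n w. \<Sum>i<n. t i * (1 / 2) ^ Suc i * g i w) S sequentially"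
      using y sub by blast
  qed
  \<comment> \<open>\<open>dilation\<close> accepts only factors at least 1, whereas
    \<open>T\<close> may be smaller.\<close>
  obtain D where D: "0 < D" "\<And>s. 0 \<le> s \<Longrightarrow> \<Phi> (max 1 T * s) \<le> D * \<Phi> s"
    using dilation[of "max 1 T"] by auto
  define h where "h n w = ennreal (\<Phi> (norm (g n w)) * Im w powr \<alpha>) * indicator \<H> w" for n w
  have [measurable]: "h n \<in> borel_measurable borel" for n
    unfolding h_def by (rule borel_measurable_modular_integrand[OF g(1)])
  have pw: "ennreal (\<Phi> (norm (S w)) * Im w powr \<alpha>) * indicator \<H> w \<le> ennreal D * (\<Sum>n. ennreal ((1 / 2) ^ Suc n) * h n w)" for w
  proof (cases "w \<in> \<H>")
    case True
    note jen = half_powers_jensen[of "\<lambda>n. norm (g n w)" "K w", OF norm_ge_zero gK[OF True]]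
    have K0: "0 \<le> K w" using gK[OF True, of 0] norm_ge_zero order_trans by blast
    have sn: "summable (\<lambda>n. (1 / 2) ^ Suc n * norm (g n w))"
      by (rule summable_comparison_test'[OF summable_mult2[OF sums_summable[OF sums_half_powers], of "K w"]])
        (auto simp: gK[OF True])
    have s: "norm (S w) \<le> max 1 T * (\<Sum>n. (1 / 2) ^ Suc n * norm (g n w))"
    proof -
      have sT: "summable (\<lambda>n. T * ((1 / 2) ^ Suc n * norm (g n w)))" by (intro summable_mult sn)
      have sN: "summable (\<lambda>n. norm (t n * (1 / 2) ^ Suc n * g n w))"
        by (rule summable_comparison_test'[OF sT]) (use term_le in auto)
      have "norm (S w) \<le> (\<Sum>n. T * ((1 / 2) ^ Suc n * norm (g n w)))"
        unfolding S_def by (rule order_trans[OF summable_norm[OF sN] suminf_le[OF term_le sN sT]])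
      also have "\<dots> = T * (\<Sum>n. (1 / 2) ^ Suc n * norm (g n w))" by (rule suminf_mult[OF sn])
      also have "\<dots> \<le> max 1 T * (\<Sum>n. (1 / 2) ^ Suc n * norm (g n w))"
        by (intro mult_right_mono suminf_nonneg sn) auto
      finally show ?thesis .
    qed
    have "\<Phi> (norm (S w)) \<le> D * \<Phi> (\<Sum>n. (1 / 2) ^ Suc n * norm (g n w))"
      by (rule order_trans[OF mono[OF norm_ge_zero s] D(2)]) (intro suminf_nonneg sn, simp)
    also have "\<dots> \<le> D * (\<Sum>n. (1 / 2) ^ Suc n * \<Phi> (norm (g n w)))"
      using D(1) jen(2) by (intro mult_left_mono) auto
    finally have "\<Phi> (norm (S w)) * Im w powr \<alpha> \<le> D * (\<Sum>n. (1 / 2) ^ Suc n * \<Phi> (norm (g n w))) * Im w powr \<alpha>"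
      by (rule mult_right_mono) simp
    also have "\<dots> = D * (\<Sum>n. (1 / 2) ^ Suc n * \<Phi> (norm (g n w)) * Im w powr \<alpha>)"
      by (simp only: suminf_mult2[OF jen(1)] mult.assoc)
    finally have "ennreal (\<Phi> (norm (S w)) * Im w powr \<alpha>) \<le> ennreal D * ennreal (\<Sum>n. (1 / 2) ^ Suc n * \<Phi> (norm (g n w)) * Im w powr \<alpha>)"
      using D(1) by (subst ennreal_mult'[symmetric]) (auto intro: ennreal_leI)
    also have "ennreal (\<Sum>n. (1 / 2) ^ Suc n * \<Phi> (norm (g n w)) * Im w powr \<alpha>) = (\<Sum>n. ennreal ((1 / 2) ^ Suc n * \<Phi> (norm (g n w)) * Im w powr \<alpha>))"
      by (rule suminf_ennreal2[symmetric]) (use nonneg summable_mult2[OF jen(1)] in auto)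
    also have "\<dots> = (\<Sum>n. ennreal ((1 / 2) ^ Suc n) * h n w)"
    proof (rule suminf_cong)
      fix n
      have "ennreal ((1 / 2) ^ Suc n * (\<Phi> (norm (g n w)) * Im w powr \<alpha>)) = ennreal ((1 / 2) ^ Suc n) * ennreal (\<Phi> (norm (g n w)) * Im w powr \<alpha>)"
        by (rule ennreal_mult') simp
      then show "ennreal ((1 / 2) ^ Suc n * \<Phi> (norm (g n w)) * Im w powr \<alpha>) = ennreal ((1 / 2) ^ Suc n) * h n w"
        using True by (simp only: h_def mult.assoc) simp
    qed
    finally show ?thesis using True by simp
  qed simp
  have "orlicz_modular \<Phi> \<alpha> S \<le> (\<integral>\<^sup>+w. ennreal D * (\<Sum>n. ennreal ((1 / 2) ^ Suc n) * h n w) \<partial>lborel)"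
    unfolding orlicz_modular_def by (intro nn_integral_mono pw)
  also have "\<dots> = ennreal D * (\<Sum>n. ennreal ((1 / 2) ^ Suc n) * orlicz_modular \<Phi> \<alpha> (g n))"
    by (subst nn_integral_cmult, simp, subst nn_integral_suminf, simp, subst nn_integral_cmult)
      (simp_all add: orlicz_modular_def h_def[symmetric])
  also have "\<dots> \<le> ennreal D * (\<Sum>n. ennreal ((1 / 2) ^ Suc n))"
  proof (intro mult_left_mono suminf_le)
    show "ennreal ((1 / 2) ^ Suc n) * orlicz_modular \<Phi> \<alpha> (g n) \<le> ennreal ((1 / 2) ^ Suc n)" for n
      using mult_left_mono[OF g(2)[of n], of "ennreal ((1 / 2) ^ Suc n)"] by simp
  qed auto
  also have "(\<Sum>n. ennreal ((1 / 2) ^ Suc n)) = ennreal (\<Sum>n. (1 / 2) ^ Suc n)"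
    by (rule suminf_ennreal2) (use sums_summable[OF sums_half_powers] in auto)
  also have "ennreal D * \<dots> < \<infinity>" by (simp add: ennreal_mult_less_top)
  finally show "orlicz_modular \<Phi> \<alpha> S < \<infinity>" .
qed

end

text \<open>A Cauchy sequence in the sup norm is uniformly Cauchy, and a uniform limit of bounded
  continuous functions is of the same kind. Over the discrete space of naturals this is the
  completeness of bounded sequences that Baire's theorem requires.\<close>

lemma complete_bcontfun: "complete (UNIV :: ('a::topological_space \<Rightarrow>\<^sub>C 'b::complete_space) set)"
  unfolding complete_def
proof (intro allI impI, elim conjE)
  fix f :: "nat \<Rightarrow> 'a \<Rightarrow>\<^sub>C 'b"
  assume "Cauchy f"
  then have "\<forall>e>0. \<exists>N. \<forall>m n x. N \<le> m \<and> N \<le> n \<and> True \<longrightarrow> dist (apply_bcontfun (f m) x) (apply_bcontfun (f n) x) < e"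
    unfolding Cauchy_def by (meson dist_fun_lt_imp_dist_val_lt)
  then obtain g where "uniform_limit UNIV (\<lambda>n. apply_bcontfun (f n)) g sequentially"
    unfolding uniformly_convergent_eq_cauchy[symmetric] uniform_limit_sequentially_iff by auto
  from uniform_limit_bcontfunE[OF this sequentially_bot]
  obtain l where "f \<longlonglongrightarrow> l" by metis
  then show "\<exists>l\<in>UNIV. f \<longlonglongrightarrow> l" by blast
qed

context young
begin

text \<open>Baire category on the space of bounded sequences: finiteness of the functional on every series
  forces a uniform bound on the individual terms.  Convexity replaces linearity, since each
  term is half the difference of two series whose coefficients differ only at that index.\<close>

lemma uniform_bound_half_powers:
  fixes g :: "nat \<Rightarrow> 'a \<Rightarrow> complex"
  assumes meas [measurable]: "\<And>n. g n \<in> borel_measurable M"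
    and B: "\<And>n x. norm (g n x) \<le> B x"
    and fin: "\<And>t :: nat \<Rightarrow> real. bounded (range t) \<Longrightarrow>
      (\<integral>\<^sup>+x. ennreal (\<Phi> (norm (\<Sum>n. of_real (t n) * (1 / 2) ^ Suc n * g n x))) \<partial>M) < \<infinity>"
  obtains r m where "0 < r" "\<And>n. (\<integral>\<^sup>+x. ennreal (\<Phi> (r * (1 / 2) ^ n * norm (g n x))) \<partial>M) \<le> ennreal (real m)"
proof -
  define S where "S t x = (\<Sum>n. of_real (apply_bcontfun t n) * (1 / 2) ^ Suc n * g n x)" for t :: "nat \<Rightarrow>\<^sub>C real" and x
  define F where "F t = (\<integral>\<^sup>+x. ennreal (\<Phi> (norm (S t x))) \<partial>M)" for t
  have B0: "0 \<le> B x" for x using B[of 0 x] norm_ge_zero order_trans by blast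
  have summ: "summable (\<lambda>n. norm t * ((1 / 2) ^ Suc n * B x))" for t :: "nat \<Rightarrow>\<^sub>C real" and x
    by (intro summable_mult summable_mult2 sums_summable[OF sums_half_powers])
  have term_le: "norm (of_real (apply_bcontfun t n) * (1 / 2) ^ Suc n * g n x) \<le> norm t * ((1 / 2) ^ Suc n * B x)" for t n x
  proof -
    have "norm (of_real (apply_bcontfun t n) * (1 / 2) ^ Suc n * g n x) = \<bar>apply_bcontfun t n\<bar> * ((1 / 2) ^ Suc n * norm (g n x))"
      by (simp add: norm_mult norm_power norm_divide)
    also have "\<dots> \<le> norm t * ((1 / 2) ^ Suc n * B x)"
      using norm_bounded[of t n] B by (intro mult_mono mult_left_mono) auto
    finally show ?thesis .
  qed
  have Ssumm: "summable (\<lambda>n. of_real (apply_bcontfun t n) * (1 / 2) ^ Suc n * g n x)" for t x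
    by (rule summable_comparison_test'[OF summ]) (rule term_le)
  have Snorm: "norm (S t x) \<le> norm t * B x" for t x
  proof -
    have sN: "summable (\<lambda>n. norm (of_real (apply_bcontfun t n) * (1 / 2) ^ Suc n * g n x))"
      by (rule summable_comparison_test'[OF summ[of t x]]) (use term_le in auto)
    have "norm (S t x) \<le> (\<Sum>n. norm t * ((1 / 2) ^ Suc n * B x))"
      unfolding S_def by (rule order_trans[OF summable_norm[OF sN] suminf_le[OF term_le sN summ]])
    also have "\<dots> = norm t * (1 * B x)"
      by (intro sums_unique[symmetric] sums_mult sums_mult2 sums_half_powers)
    finally show ?thesis by simp
  qed
  have Sdiff: "S t x - S s x = S (t - s) x" for t s x
    unfolding S_def suminf_diff[OF Ssumm Ssumm]
    by (rule suminf_cong) (simp only: minus_bcontfun.rep_eq of_real_diff left_diff_distrib)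
  have Smeas [measurable]: "S t \<in> borel_measurable M" for t
    unfolding S_def by measurable
  have Fmeas [measurable]: "(\<lambda>x. \<Phi> (norm (S t x))) \<in> borel_measurable M" for t
    by (rule borel_measurable_comp) auto
  define E where "E m = {t. F t \<le> ennreal (real m)}" for m
  \<comment> \<open>Sup-norm convergence of coefficients gives pointwise convergence of the series,
    so Fatou's lemma makes the functional lower semicontinuous, and its sublevel sets are
    closed.\<close>
  have closed: "closed (E m)" for m
  proof (subst closed_sequential_limits, intro allI impI, elim conjE)
    fix t l assume t: "\<forall>n. t n \<in> E m" and lim: "t \<longlonglongrightarrow> l"
    have "(\<lambda>n. ennreal (\<Phi> (norm (S (t n) x)))) \<longlonglongrightarrow> ennreal (\<Phi> (norm (S l x)))" for x
    proof -
      have "(\<lambda>n. norm (t n - l)) \<longlonglongrightarrow> 0"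
        using lim by (intro tendsto_norm_zero LIM_zero)
      then have *: "(\<lambda>n. norm (t n - l) * B x) \<longlonglongrightarrow> 0"
        by (rule tendsto_mult_left_zero)
      have "(\<lambda>n. S (t n) x - S l x) \<longlonglongrightarrow> 0"
        by (rule Lim_null_comparison[OF _ *]) (simp only: Sdiff Snorm eventually_True)
      then have "(\<lambda>n. norm (S (t n) x)) \<longlonglongrightarrow> norm (S l x)"
        by (intro tendsto_norm) (simp add: LIM_zero_iff)
      then show ?thesis
        by (intro tendsto_ennrealI continuous_on_tendsto_compose[OF cont]) auto
    qed
    then have "F l = (\<integral>\<^sup>+x. liminf (\<lambda>n. ennreal (\<Phi> (norm (S (t n) x)))) \<partial>M)"
      unfolding F_def by (intro nn_integral_cong lim_imp_Liminf[symmetric]) auto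
    also have "\<dots> \<le> liminf (\<lambda>n. F (t n))"
      unfolding F_def by (intro nn_integral_liminf) measurable
    also have "\<dots> \<le> liminf (\<lambda>n. ennreal (real m))"
      using t by (intro Liminf_mono) (auto simp: E_def)
    finally show "l \<in> E m" by (simp add: E_def Liminf_const)
  qed
  have cover: "(\<Union>m. E m) = UNIV"
  proof -
    have "\<exists>m. t \<in> E m" for t
    proof -
      have "bounded (range (apply_bcontfun t))"
        using norm_bounded[of t] by (auto simp: bounded_iff)
      then have "F t < \<infinity>" unfolding F_def S_def by (rule fin)
      then obtain c where "F t = ennreal c" "0 \<le> c" by (cases "F t") auto
      moreover obtain m where "c \<le> real m" using real_arch_simple by blast
      ultimately show ?thesis by (auto simp: E_def intro: ennreal_leI)
    qed
    then show ?thesis by blast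
  qed
  have "\<exists>m. interior (E m) \<noteq> {}"
  proof (rule ccontr)
    assume "\<not> ?thesis"
    then have *: "closed T \<and> interior T = {}" if "T \<in> range E" for T
      using closed that by auto
    have "complete (UNIV :: (nat \<Rightarrow>\<^sub>C real) set)" by (rule complete_bcontfun)
    then have "interior (\<Union>(range E)) = {}"
      using Met_TC.metric_Baire_category_alt[of "range E"] * by simp
    then show False using cover by simp
  qed
  then obtain m t0 where "t0 \<in> interior (E m)" by blast
  then obtain d where d: "0 < d" "ball t0 d \<subseteq> E m" by (auto simp: mem_interior)
  show ?thesis
  proof
    show "0 < d / 4" using d by simp
    fix n
    \<comment> \<open>The n-th unit sequence: moving along it changes only the n-th coefficient and
      so isolates \<open>g n\<close>.\<close>
    define e where "e = Bcontfun (\<lambda>k::nat. if k = n then 1 else 0 :: real)"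
    have e: "apply_bcontfun e k = (if k = n then 1 else 0)" for k
      unfolding e_def by (subst Bcontfun_inverse) (auto intro!: bcontfun_normI[where b = 1])
    have ne: "norm e \<le> 1" by (rule norm_bound) (simp add: e)
    \<comment> \<open>Steps of d/2 along a vector of norm at most 1 stay in the open ball of radius
      d. The same ball serves for all n, whence a bound \<open>m\<close> independent of n.\<close>
    define a b where "a = t0 + (d / 2) *\<^sub>R e" and "b = t0 - (d / 2) *\<^sub>R e"
    have ab: "a \<in> E m" "b \<in> E m"
      using d ne by (auto intro!: subsetD[OF d(2)] simp: a_def b_def dist_norm)
    have pw: "ennreal (\<Phi> (d / 4 * (1 / 2) ^ n * norm (g n x)))
        \<le> ennreal (1 / 2) * (ennreal (\<Phi> (norm (S a x))) + ennreal (\<Phi> (norm (S b x))))" for x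
    proof -
      have "a - b = d *\<^sub>R e" by (simp add: a_def b_def scaleR_2[symmetric])
      then have "S a x - S b x = S (d *\<^sub>R e) x" by (simp add: Sdiff)
      also have "\<dots> = (\<Sum>k\<in>{n}. of_real (apply_bcontfun (d *\<^sub>R e) k) * (1 / 2) ^ Suc k * g k x)"
        unfolding S_def by (rule suminf_finite) (auto simp: e scaleR_bcontfun.rep_eq)
      also have "\<dots> = of_real d * (1 / 2) ^ Suc n * g n x"
        by (simp add: e scaleR_bcontfun.rep_eq)
      finally have *: "S a x - S b x = of_real d * (1 / 2) ^ Suc n * g n x" .
      have "norm (S a x - S b x) = d * (1 / 2) ^ Suc n * norm (g n x)"
        unfolding * using d by (simp add: norm_mult norm_power norm_divide)
      \<comment> \<open>The difference of the two series is d * 2^(-n-1) * g_n. Half of it has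
        modulus d/4 * 2^(-n) * |g_n|, and the factors 1/2 on the right are the weights for midpoint
        convexity.\<close>
      then have "d / 4 * (1 / 2) ^ n * norm (g n x) \<le> (1 / 2) * norm (S a x) + (1 / 2) * norm (S b x)"
        using norm_triangle_ineq4[of "S a x" "S b x"] by simp
      then have "\<Phi> (d / 4 * (1 / 2) ^ n * norm (g n x)) \<le> \<Phi> ((1 / 2) * norm (S a x) + (1 / 2) * norm (S b x))"
        using d by (intro mono) auto
      also have "\<dots> \<le> (1 / 2) * \<Phi> (norm (S a x)) + (1 / 2) * \<Phi> (norm (S b x))"
        using convex_onD[OF convex, of "1/2" "norm (S a x)" "norm (S b x)"] by simp
      also have "\<dots> = (1 / 2) * (\<Phi> (norm (S a x)) + \<Phi> (norm (S b x)))" by simp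
      finally have "ennreal (\<Phi> (d / 4 * (1 / 2) ^ n * norm (g n x))) \<le> ennreal ((1 / 2) * (\<Phi> (norm (S a x)) + \<Phi> (norm (S b x))))"
        by (rule ennreal_leI)
      also have "\<dots> = ennreal (1 / 2) * (ennreal (\<Phi> (norm (S a x))) + ennreal (\<Phi> (norm (S b x))))"
        using nonneg by (subst ennreal_mult') auto
      finally show ?thesis .
    qed
    have "(\<integral>\<^sup>+x. ennreal (\<Phi> (d / 4 * (1 / 2) ^ n * norm (g n x))) \<partial>M)
       \<le> (\<integral>\<^sup>+x. ennreal (1 / 2) * (ennreal (\<Phi> (norm (S a x))) + ennreal (\<Phi> (norm (S b x)))) \<partial>M)"
      by (intro nn_integral_mono pw)
    also have "\<dots> = ennreal (1 / 2) * (F a + F b)"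
      unfolding F_def by (subst nn_integral_cmult, measurable, subst nn_integral_add) auto
    also have "\<dots> \<le> ennreal (1 / 2) * (ennreal (real m) + ennreal (real m))"
      using ab by (intro mult_left_mono add_mono) (auto simp: E_def)
    also have "\<dots> = ennreal (1 / 2 * (real m + real m))"
      by (subst ennreal_mult', simp, subst ennreal_plus) (rule of_nat_0_le_iff refl)+
    also have "\<dots> = ennreal (real m)" by simp
    finally show "(\<integral>\<^sup>+x. ennreal (\<Phi> (d / 4 * (1 / 2) ^ n * norm (g n x))) \<partial>M) \<le> ennreal (real m)" .
  qed
qed

section \<open>The Luxemburg norm\<close>

lemma lux_norm_set_nonempty:
  assumes "f \<in> bergman_orlicz \<Phi> \<alpha>"
  shows "{r. 0 < r \<and> orlicz_modular \<Phi> \<alpha> (\<lambda>z. f z / of_real r) \<le> 1} \<noteq> {}"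
proof -
  have f: "f holomorphic_on \<H>" "orlicz_modular \<Phi> \<alpha> f < \<infinity>" using assms by (auto simp: bergman_orlicz_def)
  obtain c where c: "orlicz_modular \<Phi> \<alpha> f = ennreal c" "0 \<le> c" using f(2) by (cases "orlicz_modular \<Phi> \<alpha> f") auto
  define r where "r = max 1 c"
  have "orlicz_modular \<Phi> \<alpha> (\<lambda>z. f z / of_real r) \<le> ennreal (1 / r) * ennreal c"
    using modular_divide[OF f(1), of r \<alpha>] c by (simp add: r_def)
  also have "\<dots> = ennreal (1 / r * c)"
    by (rule ennreal_mult'[symmetric]) (simp add: r_def)
  also have "\<dots> \<le> 1" by (simp add: r_def)
  finally show ?thesis by (auto simp: r_def intro!: exI[of _ "max 1 c"])
qed

lemma lux_norm_nonneg:
  assumes "f \<in> bergman_orlicz \<Phi> \<alpha>" shows "0 \<le> lux_norm \<Phi> \<alpha> f"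
  unfolding lux_norm_def by (rule cInf_greatest[OF lux_norm_set_nonempty[OF assms]]) auto

text \<open>The strict inequality provides an admissible radius below \<open>s\<close>, so it need
  not be shown that the infimum is attained.\<close>

lemma modular_le_1_if_lux_norm_less:
  assumes f: "f \<in> bergman_orlicz \<Phi> \<alpha>" and s: "lux_norm \<Phi> \<alpha> f < s"
  shows "orlicz_modular \<Phi> \<alpha> (\<lambda>z. f z / of_real s) \<le> 1"
proof -
  obtain r where r: "0 < r" "orlicz_modular \<Phi> \<alpha> (\<lambda>z. f z / of_real r) \<le> 1" "r < s"
    using cInf_lessD[OF lux_norm_set_nonempty[OF f] s[unfolded lux_norm_def]] by blast
  have "orlicz_modular \<Phi> \<alpha> (\<lambda>z. f z / of_real s) \<le> orlicz_modular \<Phi> \<alpha> (\<lambda>z. f z / of_real r)"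
    using r by (intro modular_mono) (auto simp: norm_divide intro!: divide_left_mono)
  then show ?thesis using r(2) by order
qed

text \<open>If the norm were 0, every positive s would be admissible, and the pointwise bound for
  f/s would force |f(z)| \<le> s K for all s > 0.\<close>

lemma lux_norm_pos:
  assumes f: "f \<in> bergman_orlicz \<Phi> \<alpha>" and z: "z \<in> \<H>" "f z \<noteq> 0"
  shows "0 < lux_norm \<Phi> \<alpha> f"
proof (rule ccontr)
  assume "\<not> ?thesis"
  then have N: "lux_norm \<Phi> \<alpha> f = 0" using lux_norm_nonneg[OF f] by simp
  obtain c where c: "0 < c" and bound: "\<And>f w. f holomorphic_on \<H> \<Longrightarrow> orlicz_modular \<Phi> \<alpha> f \<le> 1 \<Longrightarrow> w \<in> \<H> \<Longrightarrow>
      norm (f w) \<le> c * growth_inv \<Phi> (1 / Im w powr (2 + \<alpha>))"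
    using modular_pointwise_bound by blast
  define K where "K = c * growth_inv \<Phi> (1 / Im z powr (2 + \<alpha>))"
  have K: "0 \<le> K" using c by (simp add: K_def inv_nonneg)
  have hol: "f holomorphic_on \<H>" using f by (simp add: bergman_orlicz_def)
  have *: "norm (f z) \<le> s * K" if "0 < s" for s
  proof -
    have "norm (f z / of_real s) \<le> K"
      unfolding K_def using modular_le_1_if_lux_norm_less[OF f, of s] N that z(1) hol
      by (intro bound) (auto intro!: holomorphic_intros)
    then show ?thesis using that by (simp add: norm_divide field_simps)
  qed
  \<comment> \<open>This s makes s K at most half of |f(z)|; K + 1 guards against K = 0.\<close>
  have "norm (f z) \<le> norm (f z) / (2 * (K + 1)) * K" using K z by (intro *) auto
  also have "\<dots> < norm (f z)"
    using K z by (simp add: field_simps add_strict_increasing)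
  finally show False by simp
qed

end

section \<open>The equivalences\<close>

context carleson_setting
begin

text \<open>On the Carleson box over an interval, the test function at the point over its midpoint
  at height equal to its length has modulus comparable to the normalising constant.\<close>

lemma carleson_box_bound:
  assumes r: "0 < r" "r \<le> 1"
  obtains D where "0 < D" "\<And>a b m. a < b \<Longrightarrow> 0 \<le> m \<Longrightarrow>
    (\<integral>\<^sup>+w\<in>\<H>. ennreal (\<Phi>2 (r * norm (P1.test_fun \<alpha> (Complex ((a + b) / 2) (b - a)) w))) \<partial>\<mu>) \<le> ennreal m \<Longrightarrow>
    emeasure \<mu> (carleson_box {a..b} (b - a)) \<le> ennreal (D * m) / ennreal (G (b - a))"
proof -
  define \<beta> where "\<beta> = 4 + 2 * \<alpha>"
  have \<beta>: "0 \<le> \<beta>" using alpha by (simp add: \<beta>_def)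
  \<comment> \<open>The 3 comes from |z - cnj w| \<le> l + 2l on the box; dividing by r undoes the
    scaling inside \<open>\<Phi>2\<close>. The resulting D therefore depends on r.\<close>
  define k where "k = 3 powr \<beta> / r"
  have "1 \<le> 3 powr \<beta>" using \<beta> by (intro ge_one_powr_ge_zero) auto
  then have k: "1 \<le> k" using r by (simp add: k_def field_simps)
  obtain D where D: "0 < D" "\<And>t. 0 \<le> t \<Longrightarrow> \<Phi>2 (k * t) \<le> D * \<Phi>2 t" using P2.dilation[OF k] by blast
  have "emeasure \<mu> (carleson_box {a..b} (b - a)) \<le> ennreal (D * m) / ennreal (G (b - a))"
    if ab: "a < b" and m: "0 \<le> m" and
      int: "(\<integral>\<^sup>+w\<in>\<H>. ennreal (\<Phi>2 (r * norm (P1.test_fun \<alpha> (Complex ((a + b) / 2) (b - a)) w))) \<partial>\<mu>) \<le> ennreal m"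
    for a b m
  proof -
    define l z Q where "l = b - a" and "z = Complex ((a + b) / 2) l" and "Q = carleson_box {a..b} l"
    have l: "0 < l" using ab by (simp add: l_def)
    define u where "u = growth_inv \<Phi>1 (1 / l powr (2 + \<alpha>))"
    have u: "0 \<le> u" by (simp add: u_def P1.inv_nonneg)
    have low: "G l \<le> D * \<Phi>2 (r * norm (P1.test_fun \<alpha> z w))" if w: "w \<in> Q" for w
    proof -
      have wQ: "a \<le> Re w" "Re w \<le> b" "0 < Im w" "Im w < l"
        using w by (auto simp: Q_def carleson_box_def)
      have "cmod (z - cnj w) \<le> \<bar>Re (z - cnj w)\<bar> + \<bar>Im (z - cnj w)\<bar>" by (rule cmod_le)
      also have "\<bar>Re (z - cnj w)\<bar> \<le> l"
        using wQ by (simp add: z_def l_def abs_le_iff field_simps)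
      also have "\<bar>Im (z - cnj w)\<bar> \<le> 2 * l" using wQ l by (simp add: z_def)
      finally have d3: "cmod (z - cnj w) \<le> 3 * l" by simp
      have "Im (z - cnj w) \<noteq> 0" using wQ l by (simp add: z_def)
      then have d0: "0 < cmod (z - cnj w)" by auto
      have "cmod (z - cnj w) powr \<beta> \<le> (3 * l) powr \<beta>" using d3 \<beta> by (intro powr_mono2) auto
      also have "\<dots> = 3 powr \<beta> * l powr \<beta>" using l by (simp add: powr_mult)
      finally have "u * l powr \<beta> / (3 powr \<beta> * l powr \<beta>) \<le> u * l powr \<beta> / cmod (z - cnj w) powr \<beta>"
        using u d0 l by (intro divide_left_mono) auto
      also have "\<dots> = norm (P1.test_fun \<alpha> z w)"
        by (simp add: P1.norm_test_fun z_def u_def \<beta>_def)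
      finally have "u / 3 powr \<beta> \<le> norm (P1.test_fun \<alpha> z w)" using l by simp
      then have "u \<le> k * (r * norm (P1.test_fun \<alpha> z w))"
        using r by (simp add: k_def field_simps)
      then have "G l \<le> \<Phi>2 (k * (r * norm (P1.test_fun \<alpha> z w)))"
        unfolding G_def u_def[symmetric] using u by (intro P2.mono)
      also have "\<dots> \<le> D * \<Phi>2 (r * norm (P1.test_fun \<alpha> z w))" using r by (intro D) auto
      finally show ?thesis .
    qed
    have QH: "Q \<subseteq> \<H>" by (auto simp: Q_def carleson_box_def upper_half_plane_def)
    have [measurable]: "Q \<in> sets borel" by (simp add: Q_def)
    have "z \<in> \<H>" using l by (simp add: z_def upper_half_plane_def)
    then have [measurable]: "(\<lambda>w. ennreal (\<Phi>2 (r * norm (P1.test_fun \<alpha> z w))) * indicator \<H> w) \<in> borel_measurable borel"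
      using r by (intro P2.borel_measurable_young_holomorphic P1.test_fun_holomorphic) auto
    have "ennreal (G l) * emeasure \<mu> Q = (\<integral>\<^sup>+w. ennreal (G l) * indicator Q w \<partial>\<mu>)"
      by (subst nn_integral_cmult_indicator) auto
    also have "\<dots> \<le> (\<integral>\<^sup>+w. ennreal D * (ennreal (\<Phi>2 (r * norm (P1.test_fun \<alpha> z w))) * indicator \<H> w) \<partial>\<mu>)"
    proof (intro nn_integral_mono)
      fix w
      show "ennreal (G l) * indicator Q w \<le> ennreal D * (ennreal (\<Phi>2 (r * norm (P1.test_fun \<alpha> z w))) * indicator \<H> w)"
      proof (cases "w \<in> Q")
        case True
        have "ennreal (G l) \<le> ennreal (D * \<Phi>2 (r * norm (P1.test_fun \<alpha> z w)))"
          using low[OF True] by (rule ennreal_leI)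
        also have "\<dots> = ennreal D * ennreal (\<Phi>2 (r * norm (P1.test_fun \<alpha> z w)))"
          by (rule ennreal_mult') (use D(1) in auto)
        finally show ?thesis using True QH by auto
      qed simp
    qed
    also have "\<dots> = ennreal D * (\<integral>\<^sup>+w\<in>\<H>. ennreal (\<Phi>2 (r * norm (P1.test_fun \<alpha> z w))) \<partial>\<mu>)"
      by (rule nn_integral_cmult) measurable
    also have "\<dots> \<le> ennreal D * ennreal m"
      using int by (intro mult_left_mono) (auto simp: z_def l_def)
    also have "\<dots> = ennreal (D * m)" by (rule ennreal_mult'[symmetric]) (use D(1) in auto)
    finally have *: "ennreal (G l) * emeasure \<mu> Q \<le> ennreal (D * m)" .
    have G: "0 < G l" using l by (rule G_pos)
    \<comment> \<open>The measure of the box is not yet known to be finite, so the division by G is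
      carried out by multiplying with its finite inverse.\<close>
    have "emeasure \<mu> Q = ennreal (1 / G l * G l) * emeasure \<mu> Q" using G by simp
    also have "\<dots> = ennreal (1 / G l) * (ennreal (G l) * emeasure \<mu> Q)"
      using G by (subst ennreal_mult') (auto simp: mult.assoc)
    also have "\<dots> \<le> ennreal (1 / G l) * ennreal (D * m)" by (intro mult_left_mono *) simp
    also have "\<dots> = ennreal (1 / G l * (D * m))" by (rule ennreal_mult'[symmetric]) (use G in auto)
    also have "\<dots> = ennreal (D * m) / ennreal (G l)"
      using G m D(1) by (subst divide_ennreal) auto
    finally show ?thesis by (simp add: Q_def l_def)
  qed
  with D(1) show ?thesis by (rule that)
qed

text \<open>Trades one constant inside \<open>\<Phi>2\<close> for another at the cost of an outer
  factor; that factor does not depend on f, so uniform bounds survive.\<close>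

lemma nn_integral_dilation:
  assumes c: "0 < c" and T: "0 \<le> T"
  obtains D where "0 < D" "\<And>f. f holomorphic_on \<H> \<Longrightarrow>
    (\<integral>\<^sup>+w\<in>\<H>. ennreal (\<Phi>2 (T * norm (f w))) \<partial>\<mu>) \<le> ennreal D * (\<integral>\<^sup>+w\<in>\<H>. ennreal (\<Phi>2 (c * norm (f w))) \<partial>\<mu>)"
proof -
  define k where "k = max 1 (T / c)"
  obtain D where D: "0 < D" "\<And>t. 0 \<le> t \<Longrightarrow> \<Phi>2 (k * t) \<le> D * \<Phi>2 t"
    using P2.dilation[of k] by (auto simp: k_def)
  have pw: "\<Phi>2 (T * x) \<le> D * \<Phi>2 (c * x)" if "0 \<le> x" for x
  proof -
    have "T / c * (c * x) \<le> k * (c * x)" using that c by (intro mult_right_mono) (auto simp: k_def)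
    then have "\<Phi>2 (T * x) \<le> \<Phi>2 (k * (c * x))" using that c T by (intro P2.mono) auto
    also have "\<dots> \<le> D * \<Phi>2 (c * x)" using that c by (intro D) auto
    finally show ?thesis .
  qed
  have "(\<integral>\<^sup>+w\<in>\<H>. ennreal (\<Phi>2 (T * norm (f w))) \<partial>\<mu>) \<le> ennreal D * (\<integral>\<^sup>+w\<in>\<H>. ennreal (\<Phi>2 (c * norm (f w))) \<partial>\<mu>)"
    if f: "f holomorphic_on \<H>" for f
  proof -
    have "(\<integral>\<^sup>+w\<in>\<H>. ennreal (\<Phi>2 (T * norm (f w))) \<partial>\<mu>)
      \<le> (\<integral>\<^sup>+w. ennreal D * (ennreal (\<Phi>2 (c * norm (f w))) * indicator \<H> w) \<partial>\<mu>)"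
    proof (intro nn_integral_mono)
      fix w
      have "ennreal (\<Phi>2 (T * norm (f w))) \<le> ennreal (D * \<Phi>2 (c * norm (f w)))"
        by (intro ennreal_leI pw) simp
      also have "\<dots> = ennreal D * ennreal (\<Phi>2 (c * norm (f w)))"
        by (rule ennreal_mult') (use D(1) in auto)
      finally show "ennreal (\<Phi>2 (T * norm (f w))) * indicator \<H> w \<le> ennreal D * (ennreal (\<Phi>2 (c * norm (f w))) * indicator \<H> w)"
        by (simp split: split_indicator)
    qed
    also have "\<dots> = ennreal D * (\<integral>\<^sup>+w\<in>\<H>. ennreal (\<Phi>2 (c * norm (f w))) \<partial>\<mu>)"
      using P2.borel_measurable_young_holomorphic[OF f, of c] c by (intro nn_integral_cmult) (auto cong: measurable_cong_sets)
    finally show ?thesis .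
  qed
  with D(1) show ?thesis by (rule that)
qed

lemma normalized_test_fun:
  obtains C where "1 \<le> C" "\<And>z. z \<in> \<H> \<Longrightarrow> (\<lambda>w. P1.test_fun \<alpha> z w / of_real C) holomorphic_on \<H>"
    "\<And>z. z \<in> \<H> \<Longrightarrow> orlicz_modular \<Phi>1 \<alpha> (\<lambda>w. P1.test_fun \<alpha> z w / of_real C) \<le> 1"
proof -
  obtain C where C: "1 \<le> C" "\<And>z. z \<in> \<H> \<Longrightarrow> orlicz_modular \<Phi>1 \<alpha> (P1.test_fun \<alpha> z) \<le> ennreal C"
    using P1.test_fun_modular[OF alpha] by blast
  show ?thesis
  proof (rule that[OF C(1)])
    fix z assume z: "z \<in> \<H>"
    note hol = P1.test_fun_holomorphic[OF z, of \<alpha>]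
    show "(\<lambda>w. P1.test_fun \<alpha> z w / of_real C) holomorphic_on \<H>"
      using C(1) by (intro holomorphic_intros hol) auto
    have "orlicz_modular \<Phi>1 \<alpha> (\<lambda>w. P1.test_fun \<alpha> z w / of_real C) \<le> ennreal (1 / C) * orlicz_modular \<Phi>1 \<alpha> (P1.test_fun \<alpha> z)"
      by (rule P1.modular_divide[OF hol C(1)])
    also have "\<dots> \<le> ennreal (1 / C) * ennreal C" by (intro mult_left_mono C z) simp
    also have "\<dots> = ennreal (1 / C * C)" by (rule ennreal_mult'[symmetric]) (use C(1) in auto)
    also have "\<dots> = 1" using C(1) by simp
    finally show "orlicz_modular \<Phi>1 \<alpha> (\<lambda>w. P1.test_fun \<alpha> z w / of_real C) \<le> 1" .
  qed
qed

text \<open>The embedding applied to test functions divided by K, which have modular at most 1. Both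
  K and the embedding constant c are then removed by a dilation that is uniform in z.\<close>

lemma carleson_imp_test_fun_bound:
  assumes "carleson C" "0 < C"
  obtains C' where "0 < C'" "\<And>z. z \<in> \<H> \<Longrightarrow> (\<integral>\<^sup>+w\<in>\<H>. ennreal (\<Phi>2 (norm (P1.test_fun \<alpha> z w))) \<partial>\<mu>) \<le> ennreal C'"
proof -
  obtain K where K: "1 \<le> K" "\<And>z. z \<in> \<H> \<Longrightarrow> (\<lambda>w. P1.test_fun \<alpha> z w / of_real K) holomorphic_on \<H>"
    "\<And>z. z \<in> \<H> \<Longrightarrow> orlicz_modular \<Phi>1 \<alpha> (\<lambda>w. P1.test_fun \<alpha> z w / of_real K) \<le> 1"
    using normalized_test_fun by blast
  obtain c C' where c: "0 < c" "0 < C'"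
    "\<And>f. f holomorphic_on \<H> \<Longrightarrow> orlicz_modular \<Phi>1 \<alpha> f \<le> 1 \<Longrightarrow>
      (\<integral>\<^sup>+w\<in>\<H>. ennreal (\<Phi>2 (c * norm (f w))) \<partial>\<mu>) \<le> ennreal C'"
    using embedding[OF assms] by blast
  obtain D where D: "0 < D" "\<And>f. f holomorphic_on \<H> \<Longrightarrow>
    (\<integral>\<^sup>+w\<in>\<H>. ennreal (\<Phi>2 (K * norm (f w))) \<partial>\<mu>) \<le> ennreal D * (\<integral>\<^sup>+w\<in>\<H>. ennreal (\<Phi>2 (c * norm (f w))) \<partial>\<mu>)"
    using nn_integral_dilation[OF c(1), of K] K(1) by auto
  have "(\<integral>\<^sup>+w\<in>\<H>. ennreal (\<Phi>2 (norm (P1.test_fun \<alpha> z w))) \<partial>\<mu>) \<le> ennreal (D * C')" if z: "z \<in> \<H>" for z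
  proof -
    have "(\<integral>\<^sup>+w\<in>\<H>. ennreal (\<Phi>2 (norm (P1.test_fun \<alpha> z w))) \<partial>\<mu>)
       = (\<integral>\<^sup>+w\<in>\<H>. ennreal (\<Phi>2 (K * norm (P1.test_fun \<alpha> z w / of_real K))) \<partial>\<mu>)"
      using K(1) by (simp add: norm_divide)
    also have "\<dots> \<le> ennreal D * (\<integral>\<^sup>+w\<in>\<H>. ennreal (\<Phi>2 (c * norm (P1.test_fun \<alpha> z w / of_real K))) \<partial>\<mu>)"
      by (rule D(2)[OF K(2)[OF z]])
    also have "\<dots> \<le> ennreal D * ennreal C'" by (intro mult_left_mono c(3) K z) simp
    also have "\<dots> = ennreal (D * C')" by (rule ennreal_mult'[symmetric]) (use D(1) in auto)
    finally show ?thesis .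
  qed
  moreover have "0 < D * C'" using D(1) c(2) by simp
  ultimately show ?thesis using that by blast
qed

lemma test_fun_bound_imp_carleson:
  assumes "0 < C'" "\<And>z. z \<in> \<H> \<Longrightarrow> (\<integral>\<^sup>+w\<in>\<H>. ennreal (\<Phi>2 (norm (P1.test_fun \<alpha> z w))) \<partial>\<mu>) \<le> ennreal C'"
  shows "\<exists>C>0. carleson C"
proof -
  obtain D where D: "0 < D" "\<And>a b m. a < b \<Longrightarrow> 0 \<le> m \<Longrightarrow>
    (\<integral>\<^sup>+w\<in>\<H>. ennreal (\<Phi>2 (1 * norm (P1.test_fun \<alpha> (Complex ((a + b) / 2) (b - a)) w))) \<partial>\<mu>) \<le> ennreal m \<Longrightarrow>
    emeasure \<mu> (carleson_box {a..b} (b - a)) \<le> ennreal (D * m) / ennreal (G (b - a))"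
    using carleson_box_bound[of 1] by auto
  have "carleson (D * C')"
    unfolding carleson_def using assms by (intro allI impI D(2)) (auto simp: upper_half_plane_def)
  then show ?thesis using D(1) assms(1) by (intro exI[of _ "D * C'"]) simp
qed

text \<open>Test functions violating (a) at scales \<open>r n\<close> fixed in advance contradict
  the Baire bound: the scales shrink faster than the loss 2^(-n) of that bound, while the violated
  bounds n + 1 outgrow its constant.\<close>

lemma finite_embedding_imp_carleson:
  assumes fin: "\<And>f. f \<in> bergman_orlicz \<Phi>1 \<alpha> \<Longrightarrow> (\<integral>\<^sup>+w\<in>\<H>. ennreal (\<Phi>2 (norm (f w))) \<partial>\<mu>) < \<infinity>"
  shows "\<exists>C>0. carleson C"
proof (rule ccontr)
  assume neg: "\<not> ?thesis"
  obtain K where K: "1 \<le> K" "\<And>z. z \<in> \<H> \<Longrightarrow> (\<lambda>w. P1.test_fun \<alpha> z w / of_real K) holomorphic_on \<H>"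
    "\<And>z. z \<in> \<H> \<Longrightarrow> orlicz_modular \<Phi>1 \<alpha> (\<lambda>w. P1.test_fun \<alpha> z w / of_real K) \<le> 1"
    using normalized_test_fun by blast
  \<comment> \<open>Here 2^(-n) matches the loss in \<open>uniform_bound_half_powers\<close>, 1/K
    the normalisation, and 1/(n+1) eventually falls below the radius \<rho>, which is unknown at
    this point.\<close>
  define r where "r n = (1 / 2) ^ n / (K * real (Suc n))" for n
  have r: "0 < r n" "r n \<le> 1" for n
  proof -
    show "0 < r n" using K(1) by (simp add: r_def)
    have "(1 / 2 :: real) ^ n \<le> 1" by (intro power_le_one) auto
    also have "1 \<le> K * real (Suc n)" using mult_mono[of 1 K 1 "real (Suc n)"] K(1) by simp
    finally show "r n \<le> 1" using K(1) by (simp add: r_def divide_le_eq_1)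
  qed
  have "\<exists>z\<in>\<H>. \<not> (\<integral>\<^sup>+w\<in>\<H>. ennreal (\<Phi>2 (r n * norm (P1.test_fun \<alpha> z w))) \<partial>\<mu>) \<le> ennreal (real (Suc n))" for n
  proof -
    \<comment> \<open>This D varies with n through \<open>r n\<close>. That is harmless, since
      \<open>neg\<close> denies the Carleson condition for \<open>D * real (Suc n)\<close> as for
      every other positive constant.\<close>
    obtain D where D: "0 < D" "\<And>a b m. a < b \<Longrightarrow> 0 \<le> m \<Longrightarrow>
      (\<integral>\<^sup>+w\<in>\<H>. ennreal (\<Phi>2 (r n * norm (P1.test_fun \<alpha> (Complex ((a + b) / 2) (b - a)) w))) \<partial>\<mu>) \<le> ennreal m \<Longrightarrow>
      emeasure \<mu> (carleson_box {a..b} (b - a)) \<le> ennreal (D * m) / ennreal (G (b - a))"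
      using carleson_box_bound[OF r] by blast
    have "\<not> carleson (D * real (Suc n))" using neg D(1) by auto
    then obtain a b where ab: "a < b"
      "\<not> emeasure \<mu> (carleson_box {a..b} (b - a)) \<le> ennreal (D * real (Suc n)) / ennreal (G (b - a))"
      by (auto simp: carleson_def)
    show ?thesis
    proof (rule bexI)
      show "Complex ((a + b) / 2) (b - a) \<in> \<H>" using ab(1) by (simp add: upper_half_plane_def)
      show "\<not> (\<integral>\<^sup>+w\<in>\<H>. ennreal (\<Phi>2 (r n * norm (P1.test_fun \<alpha> (Complex ((a + b) / 2) (b - a)) w))) \<partial>\<mu>) \<le> ennreal (real (Suc n))"
        using D(2)[OF ab(1), of "real (Suc n)"] ab(2) of_nat_0_le_iff by blast
    qed
  qed
  then obtain z where z: "\<And>n. z n \<in> \<H>"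
    and notle: "\<And>n. \<not> (\<integral>\<^sup>+w\<in>\<H>. ennreal (\<Phi>2 (r n * norm (P1.test_fun \<alpha> (z n) w))) \<partial>\<mu>) \<le> ennreal (real (Suc n))"
    by metis
  define g where "g n w = P1.test_fun \<alpha> (z n) w / of_real K" for n w
  have g: "g n holomorphic_on \<H>" "orlicz_modular \<Phi>1 \<alpha> (g n) \<le> 1" for n
    using K(2,3)[OF z[of n]] by (auto simp: g_def[abs_def])
  \<comment> \<open>The Baire argument needs measurability and a pointwise majorant at every point
    of the plane; extending by zero provides both and changes no integral against
    \<open>M\<close>.\<close>
  define h where "h n w = of_real (indicator \<H> w) * g n w" for n w
  have hmeas: "h n \<in> borel_measurable M" for n
  proof -
    have "(\<lambda>w. indicator \<H> w *\<^sub>R g n w) \<in> borel_measurable borel"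
      using g(1)[of n] by (intro borel_measurable_continuous_on_indicator holomorphic_on_imp_continuous_on) auto
    then show ?thesis by (simp add: h_def[abs_def] scaleR_conv_of_real cong: measurable_cong_sets)
  qed
  obtain c where c: "0 < c" and bound: "\<And>f w. f holomorphic_on \<H> \<Longrightarrow> orlicz_modular \<Phi>1 \<alpha> f \<le> 1 \<Longrightarrow> w \<in> \<H> \<Longrightarrow>
      norm (f w) \<le> c * growth_inv \<Phi>1 (1 / Im w powr (2 + \<alpha>))"
    using P1.modular_pointwise_bound by blast
  have hB: "norm (h n w) \<le> indicator \<H> w * (c * growth_inv \<Phi>1 (1 / Im w powr (2 + \<alpha>)))" for n w
    using bound[OF g, of w n] by (simp add: h_def split: split_indicator)
  have on_H: "(\<integral>\<^sup>+w. ennreal (\<Phi>2 (norm (indicator \<H> w * f w))) \<partial>M) = (\<integral>\<^sup>+w\<in>\<H>. ennreal (\<Phi>2 (norm (f w))) \<partial>\<mu>)"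
    if f: "f holomorphic_on \<H>" for f
  proof -
    have eq: "ennreal (\<Phi>2 (norm (indicator \<H> w * f w))) = ennreal (\<Phi>2 (1 * norm (f w))) * indicator \<H> w" for w
      by (simp add: P2.zero split: split_indicator)
    show ?thesis
      unfolding eq
      by (subst nn_integral_M[OF P2.borel_measurable_young_holomorphic[OF f]])
        (auto intro!: nn_integral_cong split: split_indicator)
  qed
  have fin_series: "(\<integral>\<^sup>+w. ennreal (\<Phi>2 (norm (\<Sum>n. complex_of_real (t n) * (1 / 2) ^ Suc n * h n w))) \<partial>M) < \<infinity>"
    if t: "bounded (range t)" for t :: "nat \<Rightarrow> real"
  proof -
    obtain T where T: "\<And>n. norm (complex_of_real (t n)) \<le> T" using t by (auto simp: bounded_iff)
    define S where "S w = (\<Sum>n. complex_of_real (t n) * (1 / 2) ^ Suc n * g n w)" for w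
    have S: "S holomorphic_on \<H>" "orlicz_modular \<Phi>1 \<alpha> S < \<infinity>"
      using P1.modular_half_powers_series[OF g T] by (auto simp: S_def[abs_def])
    have "(\<Sum>n. complex_of_real (t n) * (1 / 2) ^ Suc n * h n w) = indicator \<H> w * S w" for w
      by (simp add: S_def h_def split: split_indicator)
    then have "(\<integral>\<^sup>+w. ennreal (\<Phi>2 (norm (\<Sum>n. complex_of_real (t n) * (1 / 2) ^ Suc n * h n w))) \<partial>M)
        = (\<integral>\<^sup>+w\<in>\<H>. ennreal (\<Phi>2 (norm (S w))) \<partial>\<mu>)"
      using on_H[OF S(1)] by simp
    also have "\<dots> < \<infinity>" using S by (intro fin) (auto simp: bergman_orlicz_def)
    finally show ?thesis .
  qed
  obtain \<rho> m where \<rho>: "0 < \<rho>" and unif: "\<And>n. (\<integral>\<^sup>+w. ennreal (\<Phi>2 (\<rho> * (1 / 2) ^ n * norm (h n w))) \<partial>M) \<le> ennreal (real m)"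
    using P2.uniform_bound_half_powers[OF hmeas hB fin_series] by blast
  \<comment> \<open>Taking n \<ge> 1/\<rho> makes \<open>r n\<close> at most \<rho> 2^(-n) / K, and
    n \<ge> m puts the uniform bound below the violated bound n + 1.\<close>
  obtain n where n: "max (real m) (1 / \<rho>) \<le> real n" using real_arch_simple by blast
  have "(\<integral>\<^sup>+w\<in>\<H>. ennreal (\<Phi>2 (r n * norm (P1.test_fun \<alpha> (z n) w))) \<partial>\<mu>)
     \<le> (\<integral>\<^sup>+w\<in>\<H>. ennreal (\<Phi>2 (norm (of_real (\<rho> * (1 / 2) ^ n) * g n w))) \<partial>\<mu>)"
  proof (intro nn_integral_mono mult_right_mono ennreal_leI P2.mono)
    fix w
    have "1 / real (Suc n) \<le> \<rho>" using n \<rho> by (simp add: field_simps)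
    then have "(1 / 2) ^ n * norm (P1.test_fun \<alpha> (z n) w) / K * (1 / real (Suc n)) \<le> (1 / 2) ^ n * norm (P1.test_fun \<alpha> (z n) w) / K * \<rho>"
      using K(1) by (intro mult_left_mono) auto
    then show "r n * norm (P1.test_fun \<alpha> (z n) w) \<le> norm (of_real (\<rho> * (1 / 2) ^ n) * g n w)"
      using K(1) \<rho> by (simp add: r_def g_def norm_mult norm_divide norm_power mult_ac)
    show "0 \<le> r n * norm (P1.test_fun \<alpha> (z n) w)" using r(1)[of n] by simp
  qed simp
  also have "\<dots> = (\<integral>\<^sup>+w. ennreal (\<Phi>2 (norm (indicator \<H> w * (of_real (\<rho> * (1 / 2) ^ n) * g n w)))) \<partial>M)"
    by (intro on_H[symmetric] holomorphic_intros g)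
  also have "\<dots> = (\<integral>\<^sup>+w. ennreal (\<Phi>2 (\<rho> * (1 / 2) ^ n * norm (h n w))) \<partial>M)"
    using \<rho> by (intro nn_integral_cong arg_cong[where f = ennreal] arg_cong[where f = \<Phi>2])
      (simp add: h_def norm_mult norm_divide norm_power split: split_indicator)
  also have "\<dots> \<le> ennreal (real m)" by (rule unif)
  also have "\<dots> \<le> ennreal (real (Suc n))" using n by (intro ennreal_leI) auto
  finally show False using notle by blast
qed

lemma carleson_imp_embedding:
  assumes "carleson C" "0 < C"
  obtains C3 where "0 < C3" "\<And>f. f \<in> bergman_orlicz \<Phi>1 \<alpha> \<Longrightarrow>
    (\<integral>\<^sup>+w\<in>\<H>. ennreal (\<Phi>2 (norm (f w) / (C3 * lux_norm \<Phi>1 \<alpha> f))) \<partial>\<mu>) < \<infinity>"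
proof -
  obtain c C' where c: "0 < c" "0 < C'"
    "\<And>f. f holomorphic_on \<H> \<Longrightarrow> orlicz_modular \<Phi>1 \<alpha> f \<le> 1 \<Longrightarrow>
      (\<integral>\<^sup>+w\<in>\<H>. ennreal (\<Phi>2 (c * norm (f w))) \<partial>\<mu>) \<le> ennreal C'"
    using embedding[OF assms] by blast
  show ?thesis
  \<comment> \<open>The 2 replaces the norm N by 2N, which lies strictly above it when N > 0, so
    that \<open>modular_le_1_if_lux_norm_less\<close> applies.\<close>
  proof (rule that[of "2 / c"])
    fix f assume f: "f \<in> bergman_orlicz \<Phi>1 \<alpha>"
    define N where "N = lux_norm \<Phi>1 \<alpha> f"
    show "(\<integral>\<^sup>+w\<in>\<H>. ennreal (\<Phi>2 (norm (f w) / (2 / c * lux_norm \<Phi>1 \<alpha> f))) \<partial>\<mu>) < \<infinity>"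
    proof (cases "N = 0")
      case True
      \<comment> \<open>Division by 0 yields 0, so for N = 0 the integrand is
        \<open>\<Phi>2 0\<close>, which vanishes.\<close>
      then show ?thesis by (simp add: N_def P2.zero)
    next
      case False
      then have N: "0 < N" using P1.lux_norm_nonneg[OF f] by (simp add: N_def)
      have "(\<integral>\<^sup>+w\<in>\<H>. ennreal (\<Phi>2 (c * norm (f w / of_real (2 * N)))) \<partial>\<mu>) \<le> ennreal C'"
        using f N by (intro c(3) P1.modular_le_1_if_lux_norm_less holomorphic_intros) (auto simp: bergman_orlicz_def N_def)
      moreover have "c * norm (f w / of_real (2 * N)) = norm (f w) / (2 / c * N)" for w
        using N c(1) by (simp add: norm_divide norm_mult field_simps)
      ultimately have "(\<integral>\<^sup>+w\<in>\<H>. ennreal (\<Phi>2 (norm (f w) / (2 / c * N))) \<partial>\<mu>) \<le> ennreal C'" by simp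
      also have "\<dots> < \<infinity>" by simp
      finally show ?thesis by (simp add: N_def)
    qed
  qed (use c in auto)
qed

text \<open>Removes the normalisation by the norm. The dilation constant depends on f through its
  norm, which is acceptable because only finiteness is passed on; \<open>lux_norm_pos\<close>
  excludes division by 0.\<close>

lemma embedding_imp_carleson:
  assumes C3: "0 < C3" and emb: "\<And>f. f \<in> bergman_orlicz \<Phi>1 \<alpha> \<Longrightarrow> \<exists>z\<in>\<H>. f z \<noteq> 0 \<Longrightarrow>
    (\<integral>\<^sup>+w\<in>\<H>. ennreal (\<Phi>2 (norm (f w) / (C3 * lux_norm \<Phi>1 \<alpha> f))) \<partial>\<mu>) < \<infinity>"
  shows "\<exists>C>0. carleson C"
proof (rule finite_embedding_imp_carleson)
  fix f assume f: "f \<in> bergman_orlicz \<Phi>1 \<alpha>"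
  show "(\<integral>\<^sup>+w\<in>\<H>. ennreal (\<Phi>2 (norm (f w))) \<partial>\<mu>) < \<infinity>"
  proof (cases "\<exists>z\<in>\<H>. f z \<noteq> 0")
    case True
    define N where "N = lux_norm \<Phi>1 \<alpha> f"
    have N: "0 < N" using True P1.lux_norm_pos[OF f] by (auto simp: N_def)
    have hol: "f holomorphic_on \<H>" using f by (simp add: bergman_orlicz_def)
    have "0 < 1 / (C3 * N)" using C3 N by simp
    from nn_integral_dilation[OF this zero_le_one]
    obtain D where "0 < D" and D: "\<And>f. f holomorphic_on \<H> \<Longrightarrow> (\<integral>\<^sup>+w\<in>\<H>. ennreal (\<Phi>2 (1 * norm (f w))) \<partial>\<mu>)
      \<le> ennreal D * (\<integral>\<^sup>+w\<in>\<H>. ennreal (\<Phi>2 (1 / (C3 * N) * norm (f w))) \<partial>\<mu>)"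
      by blast
    note D[OF hol]
    moreover have "ennreal D * (\<integral>\<^sup>+w\<in>\<H>. ennreal (\<Phi>2 (1 / (C3 * N) * norm (f w))) \<partial>\<mu>) < \<infinity>"
      using emb[OF f True] by (simp add: N_def ennreal_mult_less_top)
    ultimately show ?thesis by (simp add: le_less_trans)
  next
    case False
    then have "(\<integral>\<^sup>+w\<in>\<H>. ennreal (\<Phi>2 (norm (f w))) \<partial>\<mu>) = (\<integral>\<^sup>+w. 0 \<partial>\<mu>)"
      by (intro nn_integral_cong) (auto simp: P2.zero split: split_indicator)
    then show ?thesis by simp
  qed
qed

end

section \<open>From the hypotheses of the theorem to the common setting\<close>

lemma dilation_if_Delta2:
  assumes growth: "growth_fun \<Phi>" and "Delta2 \<Phi>" and c: "1 \<le> c"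
  shows "\<exists>D>0. \<forall>t\<ge>0. \<Phi> (c * t) \<le> D * \<Phi> t"
proof -
  obtain K where K: "1 < K" "\<And>t. 0 \<le> t \<Longrightarrow> \<Phi> (2 * t) \<le> K * \<Phi> t"
    using assms by (auto simp: Delta2_def)
  obtain k where k: "c < 2 ^ k" using real_arch_pow[of 2 c] by auto
  have pow: "\<Phi> (2 ^ n * t) \<le> K ^ n * \<Phi> t" if "0 \<le> t" for n t
  proof (induction n)
    case (Suc n)
    have "\<Phi> (2 ^ Suc n * t) \<le> K * \<Phi> (2 ^ n * t)" using K(2)[of "2 ^ n * t"] that by (simp add: mult.assoc)
    also have "\<dots> \<le> K * (K ^ n * \<Phi> t)" using Suc K(1) by (intro mult_left_mono) auto
    finally show ?case by (simp add: mult.assoc)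
  qed simp
  have "\<Phi> (c * t) \<le> K ^ k * \<Phi> t" if t: "0 \<le> t" for t
  proof -
    have "c * t \<le> 2 ^ k * t" using k t by (intro mult_right_mono) auto
    then have "\<Phi> (c * t) \<le> \<Phi> (2 ^ k * t)"
      using growth c t by (auto simp: growth_fun_def mono_on_def)
    also have "\<dots> \<le> K ^ k * \<Phi> t" by (rule pow[OF t])
    finally show ?thesis .
  qed
  then show ?thesis using K(1) by (intro exI[of _ "K ^ k"]) auto
qed

lemma dilation_if_upper_type:
  assumes growth: "growth_fun \<Phi>" and "upper_type \<Phi> q" and c: "1 \<le> c"
  shows "\<exists>D>0. \<forall>t\<ge>0. \<Phi> (c * t) \<le> D * \<Phi> t"
proof -
  obtain C where C: "\<And>s t. 0 < s \<Longrightarrow> 1 \<le> t \<Longrightarrow> \<Phi> (s * t) \<le> C * t powr q * \<Phi> s"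
    using assms by (auto simp: upper_type_def)
  have nonneg: "0 \<le> \<Phi> t" if "0 \<le> t" for t
    using growth that unfolding growth_fun_def by (metis atLeast_iff imageI)
  \<comment> \<open>The constant of the upper type carries no sign, and its inequality concerns only
    s > 0; the maximum with 1 makes D positive and covers t = 0.\<close>
  define D where "D = max 1 (C * c powr q)"
  have "\<Phi> (c * t) \<le> D * \<Phi> t" if t: "0 \<le> t" for t
  proof (cases "t = 0")
    case True
    then show ?thesis using mult_right_mono[of 1 D "\<Phi> 0"] nonneg[of 0] by (simp add: D_def)
  next
    case False
    then have "\<Phi> (c * t) \<le> C * c powr q * \<Phi> t" using C[of t c] t c by (simp add: mult.commute)
    also have "\<dots> \<le> D * \<Phi> t" using nonneg[OF t] by (intro mult_right_mono) (auto simp: D_def)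
    finally show ?thesis .
  qed
  then show ?thesis by (intro exI[of _ D]) (auto simp: D_def)
qed

text \<open>Only positivity needs an argument: a growth function could vanish on an initial
  interval, but dilation would spread a zero at t > 0 to every larger argument, contradicting
  surjectivity.\<close>

lemma youngI:
  assumes growth: "growth_fun \<Phi>" and convex: "convex_on {0..} \<Phi>"
    and dilation: "\<And>c. 1 \<le> c \<Longrightarrow> \<exists>D>0. \<forall>t\<ge>0. \<Phi> (c * t) \<le> D * \<Phi> t"
  shows "young \<Phi>"
proof (unfold_locales, rule growth, rule convex)
  fix t :: real assume t: "0 < t"
  have img: "\<Phi> ` {0..} = {0..}" and mono: "\<And>s t. 0 \<le> s \<Longrightarrow> s \<le> t \<Longrightarrow> \<Phi> s \<le> \<Phi> t"
    using growth by (auto simp: growth_fun_def mono_on_def)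
  have "1 \<in> \<Phi> ` {0..}" unfolding img by simp
  then obtain s where s: "0 \<le> s" "\<Phi> s = 1" by auto
  have "0 \<le> \<Phi> t" using img t by (metis atLeast_iff imageI less_imp_le)
  moreover have "\<Phi> t \<noteq> 0"
  proof
    assume z: "\<Phi> t = 0"
    \<comment> \<open>The factor carries t to a point at or beyond s, where the value is at least
      1.\<close>
    obtain D where D: "\<And>x. 0 \<le> x \<Longrightarrow> \<Phi> (max 1 (s / t) * x) \<le> D * \<Phi> x"
      using dilation[of "max 1 (s / t)"] by auto
    have "\<Phi> (max 1 (s / t) * t) \<le> 0" using D[of t] t z by simp
    moreover have "s \<le> max 1 (s / t) * t" using t by (simp add: max_mult_distrib_right)
    ultimately show False using mono[OF s(1)] s(2) by fastforce
  qed
  ultimately show "0 < \<Phi> t" by simp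
qed (rule dilation)

theorem theorem2p2:
  fixes \<Phi>1 \<Phi>2 :: "real \<Rightarrow> real" and \<mu> :: "complex measure" and \<alpha> :: real
  assumes "growth_fun \<Phi>1" and "growth_fun \<Phi>2"
    and "C1_on_nonneg \<Phi>1" and "C1_on_nonneg \<Phi>2"
    and "convex_on {0..} \<Phi>1" and "convex_on {0..} \<Phi>2"
    and "\<Phi>2 \<in> class_U"
    and "Nabla2 \<Phi>1"
    and "mono_on {0<..} (\<lambda>t. \<Phi>2 t / \<Phi>1 t)"
    and "sets \<mu> = sets borel"
    and "\<alpha> > -1"
  shows
   "((\<exists>C1>0. \<forall>I a b. a < b \<and> {a<..<b} \<subseteq> I \<and> I \<subseteq> {a..b} \<longrightarrow>
        emeasure \<mu> (carleson_box I (b - a))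
          \<le> ennreal C1 / ennreal (\<Phi>2 (growth_inv \<Phi>1 (1 / (b - a) powr (2 + \<alpha>)))))
    \<longleftrightarrow>
     (\<exists>C2>0. (SUP z\<in>upper_half_plane.
        \<integral>\<^sup>+ w\<in>upper_half_plane.
          ennreal (\<Phi>2 (growth_inv \<Phi>1 (1 / Im z powr (2 + \<alpha>))
                 * Im z powr (4 + 2 * \<alpha>) / cmod (z - cnj w) powr (4 + 2 * \<alpha>))) \<partial>\<mu>)
        \<le> ennreal C2))
   \<and>
   ((\<exists>C1>0. \<forall>I a b. a < b \<and> {a<..<b} \<subseteq> I \<and> I \<subseteq> {a..b} \<longrightarrow>
        emeasure \<mu> (carleson_box I (b - a))
          \<le> ennreal C1 / ennreal (\<Phi>2 (growth_inv \<Phi>1 (1 / (b - a) powr (2 + \<alpha>)))))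
    \<longleftrightarrow>
     (\<exists>C3>0. \<forall>f. f \<in> bergman_orlicz \<Phi>1 \<alpha> \<and> (\<exists>z\<in>upper_half_plane. f z \<noteq> 0) \<longrightarrow>
        (\<integral>\<^sup>+ z\<in>upper_half_plane.
           ennreal (\<Phi>2 (cmod (f z) / (C3 * lux_norm \<Phi>1 \<alpha> f))) \<partial>\<mu>) < \<infinity>))"
proof -
  obtain q where q: "upper_type \<Phi>2 q"
    using assms(7) by (auto simp: class_U_def class_U_q_def)
  have Y1: "young \<Phi>1"
    using assms(1,5,8) by (intro youngI dilation_if_Delta2) (auto simp: Nabla2_def)
  have Y2: "young \<Phi>2"
    using assms(2,6) q by (intro youngI dilation_if_upper_type)
  interpret carleson_setting \<Phi>1 \<Phi>2 \<alpha> \<mu>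
    by (intro carleson_setting.intro Y1 Y2 carleson_setting_axioms.intro assms)
  \<comment> \<open>Each assertion is compared with \<open>carleson\<close>. Here \<open>I\<close>
    is squeezed between the open and the closed interval with endpoints a and b, which covers all
    four types of bounded interval.\<close>
  have a_iff: "(\<exists>C1>0. \<forall>I a b. a < b \<and> {a<..<b} \<subseteq> I \<and> I \<subseteq> {a..b} \<longrightarrow>
        emeasure \<mu> (carleson_box I (b - a))
          \<le> ennreal C1 / ennreal (\<Phi>2 (growth_inv \<Phi>1 (1 / (b - a) powr (2 + \<alpha>))))) \<longleftrightarrow> (\<exists>C>0. carleson C)"
    (is "?a \<longleftrightarrow> _")
  proof
    assume ?a
    then obtain C1 where C1: "0 < C1 \<and> (\<forall>I a b. a < b \<and> {a<..<b} \<subseteq> I \<and> I \<subseteq> {a..b} \<longrightarrow>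
        emeasure \<mu> (carleson_box I (b - a)) \<le> ennreal C1 / ennreal (\<Phi>2 (growth_inv \<Phi>1 (1 / (b - a) powr (2 + \<alpha>)))))" ..
    have "carleson C1"
      unfolding carleson_def G_def
    proof (intro allI impI)
      fix a b :: real assume "a < b"
      then show "emeasure \<mu> (carleson_box {a..b} (b - a)) \<le> ennreal C1 / ennreal (\<Phi>2 (growth_inv \<Phi>1 (1 / (b - a) powr (2 + \<alpha>))))"
        by (intro C1[THEN conjunct2, rule_format]) auto
    qed
    with C1 show "\<exists>C>0. carleson C" by blast
  next
    assume "\<exists>C>0. carleson C"
    then obtain C where C: "0 < C" "carleson C" by blast
    show ?a
    proof (intro exI[of _ C] conjI C(1) allI impI, elim conjE)
      fix I and a b :: real
      assume I: "a < b" "{a<..<b} \<subseteq> I" "I \<subseteq> {a..b}"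
      have "emeasure \<mu> (carleson_box I (b - a)) \<le> emeasure \<mu> (carleson_box {a..b} (b - a))"
        using I(3) by (intro emeasure_mono) (auto simp: carleson_box_def)
      also have "\<dots> \<le> ennreal C / ennreal (\<Phi>2 (growth_inv \<Phi>1 (1 / (b - a) powr (2 + \<alpha>))))"
        using C(2) I(1) unfolding carleson_def G_def by blast
      finally show "emeasure \<mu> (carleson_box I (b - a)) \<le> ennreal C / ennreal (\<Phi>2 (growth_inv \<Phi>1 (1 / (b - a) powr (2 + \<alpha>))))" .
    qed
  qed
  have b_iff: "(\<exists>C2>0. (SUP z\<in>\<H>.
        \<integral>\<^sup>+ w\<in>\<H>.
          ennreal (\<Phi>2 (growth_inv \<Phi>1 (1 / Im z powr (2 + \<alpha>))
                 * Im z powr (4 + 2 * \<alpha>) / cmod (z - cnj w) powr (4 + 2 * \<alpha>))) \<partial>\<mu>)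
        \<le> ennreal C2) \<longleftrightarrow> (\<exists>C>0. carleson C)"
  proof
    assume "\<exists>C>0. carleson C"
    then obtain C where "0 < C" "carleson C" by blast
    from carleson_imp_test_fun_bound[OF this(2,1)]
    obtain C' where "0 < C'" "\<And>z. z \<in> \<H> \<Longrightarrow> (\<integral>\<^sup>+w\<in>\<H>. ennreal (\<Phi>2 (norm (P1.test_fun \<alpha> z w))) \<partial>\<mu>) \<le> ennreal C'"
      by blast
    then show "\<exists>C2>0. (SUP z\<in>\<H>.
        \<integral>\<^sup>+ w\<in>\<H>.
          ennreal (\<Phi>2 (growth_inv \<Phi>1 (1 / Im z powr (2 + \<alpha>))
                 * Im z powr (4 + 2 * \<alpha>) / cmod (z - cnj w) powr (4 + 2 * \<alpha>))) \<partial>\<mu>)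
        \<le> ennreal C2"
      unfolding P1.norm_test_fun by (intro exI[of _ C'] conjI SUP_least)
  next
    assume "\<exists>C2>0. (SUP z\<in>\<H>.
        \<integral>\<^sup>+ w\<in>\<H>.
          ennreal (\<Phi>2 (growth_inv \<Phi>1 (1 / Im z powr (2 + \<alpha>))
                 * Im z powr (4 + 2 * \<alpha>) / cmod (z - cnj w) powr (4 + 2 * \<alpha>))) \<partial>\<mu>)
        \<le> ennreal C2"
    then obtain C2 where "0 < C2" "\<And>z. z \<in> \<H> \<Longrightarrow> (\<integral>\<^sup>+w\<in>\<H>. ennreal (\<Phi>2 (norm (P1.test_fun \<alpha> z w))) \<partial>\<mu>) \<le> ennreal C2"
      unfolding P1.norm_test_fun SUP_le_iff by blast
    then show "\<exists>C>0. carleson C" by (rule test_fun_bound_imp_carleson)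
  qed
  have c_iff: "(\<exists>C3>0. \<forall>f. f \<in> bergman_orlicz \<Phi>1 \<alpha> \<and> (\<exists>z\<in>\<H>. f z \<noteq> 0) \<longrightarrow>
        (\<integral>\<^sup>+ z\<in>\<H>. ennreal (\<Phi>2 (cmod (f z) / (C3 * lux_norm \<Phi>1 \<alpha> f))) \<partial>\<mu>) < \<infinity>) \<longleftrightarrow> (\<exists>C>0. carleson C)"
  proof
    assume "\<exists>C>0. carleson C"
    then obtain C where "0 < C" "carleson C" by blast
    from carleson_imp_embedding[OF this(2,1)]
    show "\<exists>C3>0. \<forall>f. f \<in> bergman_orlicz \<Phi>1 \<alpha> \<and> (\<exists>z\<in>\<H>. f z \<noteq> 0) \<longrightarrow>
        (\<integral>\<^sup>+ z\<in>\<H>. ennreal (\<Phi>2 (cmod (f z) / (C3 * lux_norm \<Phi>1 \<alpha> f))) \<partial>\<mu>) < \<infinity>"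
      by metis
  qed (use embedding_imp_carleson in blast)
  show ?thesis unfolding a_iff b_iff c_iff by simp
qed

end
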